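(* There exists a non-periodic metabelian $FC^2$-group $G$ such that $$\overline{R}(G)=Z_{\omega}(G)\quad\text{and}\quad R(G)=Z_{\omega+1}(G)=G,$$ and such that, further, $Z_{\omega}(G)$ is periodic and $G$ is an $ERF$-group.
   Context: Commutators: $x^y=y^{-1}xy$, $[x,_1 y]=[x,y]=x^{-1}x^y$, and $[x,_m y]=[[x,_{m-1}y],y]$ for $m\geq 2$. For a group $G$, $R(G)$ is the set of right Engel elements, i.e. those $a\in G$ such that for every $g\in G$ there is $m=m(a,g)\geq 1$ with $[a,_m g]=1$; $\overline{R}(G)$ is the set of bounded right Engel elements, i.e. those $a\in G$ for which there is a single $m=m(a)\geq 1$ with $[a,_m g]=1$ for all $g\in G$. For $x\in G$, $x^G$ denotes the normal closure of $\langle x\rangle$ in $G$. $FC^0$ is the class of finite groups; for $n\geq 1$, a group $G$ is an $FC^n$-group if for every $x\in G$ the factor group $G/C_G(x^G)$ belongs to $FC^{n-1}$. A group $G$ is an $ERF$-group (extended residually finite) if every subgroup of $G$ is an intersection of subgroups of finite index in $G$. $Z_k(G)$ ($k\ge 0$ an integer) is the $k$-th term of the upper central series of $G$, $Z_\omega(G)=\bigcup_{k<\omega}Z_k(G)$, and $Z_{\omega+1}(G)/Z_\omega(G)$ is the centre of $G/Z_\omega(G)$. A group is periodic if all its elements have finite order. *)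

theory Defs
  imports "HOL-Algebra.Algebra"
begin

section \<open>Commutators and right Engel elements\<close>

definition conjug :: "('a, 'b) monoid_scheme \<Rightarrow> 'a \<Rightarrow> 'a \<Rightarrow> 'a"
  where "conjug G x y = inv\<^bsub>G\<^esub> y \<otimes>\<^bsub>G\<^esub> x \<otimes>\<^bsub>G\<^esub> y"

definition commutator :: "('a, 'b) monoid_scheme \<Rightarrow> 'a \<Rightarrow> 'a \<Rightarrow> 'a"
  where "commutator G x y = inv\<^bsub>G\<^esub> x \<otimes>\<^bsub>G\<^esub> conjug G x y"

text \<open>The iterated commutator starts at \<open>m = 0\<close> with \<open>x\<close> itself, so that \<open>m = 1\<close> gives
  \<open>commutator G x y\<close>.\<close>

primrec iter_commutator :: "('a, 'b) monoid_scheme \<Rightarrow> 'a \<Rightarrow> nat \<Rightarrow> 'a \<Rightarrow> 'a"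
  where
    "iter_commutator G x 0 y = x"
  | "iter_commutator G x (Suc m) y = commutator G (iter_commutator G x m y) y"

definition right_engel :: "('a, 'b) monoid_scheme \<Rightarrow> 'a set"
  where "right_engel G =
    {a \<in> carrier G. \<forall>g \<in> carrier G. \<exists>m\<ge>1. iter_commutator G a m g = \<one>\<^bsub>G\<^esub>}"

definition bounded_right_engel :: "('a, 'b) monoid_scheme \<Rightarrow> 'a set"
  where "bounded_right_engel G =
    {a \<in> carrier G. \<exists>m\<ge>1. \<forall>g \<in> carrier G. iter_commutator G a m g = \<one>\<^bsub>G\<^esub>}"


section \<open>Groups with restricted conjugacy classes\<close>

definition normal_closure :: "('a, 'b) monoid_scheme \<Rightarrow> 'a set \<Rightarrow> 'a set"
  where "normal_closure G S = \<Inter> {N. N \<lhd> G \<and> S \<subseteq> N}"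

definition centralizer :: "('a, 'b) monoid_scheme \<Rightarrow> 'a set \<Rightarrow> 'a set"
  where "centralizer G S =
    {g \<in> carrier G. \<forall>s \<in> S. g \<otimes>\<^bsub>G\<^esub> s = s \<otimes>\<^bsub>G\<^esub> g}"

text \<open>Passing from \<open>G\<close> to a factor group changes the element type from \<open>'a\<close> to \<open>'a set\<close>, so
  the hierarchy \<open>FC^n\<close> is not a recursion on \<open>n\<close> in HOL: \<open>FC_step\<close> is its recursion step, which
  is applied at a new type for each level.\<close>

definition FC_step :: "('a set monoid \<Rightarrow> bool) \<Rightarrow> ('a, 'b) monoid_scheme \<Rightarrow> bool"
  where "FC_step P G \<longleftrightarrow> group G \<and>
    (\<forall>x \<in> carrier G. P (G Mod centralizer G (normal_closure G (generate G {x}))))"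

definition FC0_group :: "('a, 'b) monoid_scheme \<Rightarrow> bool"
  where "FC0_group G \<longleftrightarrow> group G \<and> finite (carrier G)"

definition FC1_group :: "('a, 'b) monoid_scheme \<Rightarrow> bool"
  where "FC1_group G \<longleftrightarrow> FC_step FC0_group G"

definition FC2_group :: "('a, 'b) monoid_scheme \<Rightarrow> bool"
  where "FC2_group G \<longleftrightarrow> FC_step FC1_group G"


section \<open>Upper central series\<close>

definition group_center :: "('a, 'b) monoid_scheme \<Rightarrow> 'a set"
  where "group_center G = centralizer G (carrier G)"

text \<open>The full preimage in \<open>G\<close> of the centre of \<open>G/N\<close>.\<close>

definition center_above :: "('a, 'b) monoid_scheme \<Rightarrow> 'a set \<Rightarrow> 'a set"
  where "center_above G N = {g \<in> carrier G. N #>\<^bsub>G\<^esub> g \<in> group_center (G Mod N)}"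

primrec upper_central :: "('a, 'b) monoid_scheme \<Rightarrow> nat \<Rightarrow> 'a set"
  where
    "upper_central G 0 = {\<one>\<^bsub>G\<^esub>}"
  | "upper_central G (Suc k) = center_above G (upper_central G k)"

definition upper_central_omega :: "('a, 'b) monoid_scheme \<Rightarrow> 'a set"
  where "upper_central_omega G = (\<Union>k. upper_central G k)"

definition upper_central_omega_Suc :: "('a, 'b) monoid_scheme \<Rightarrow> 'a set"
  where "upper_central_omega_Suc G = center_above G (upper_central_omega G)"


section \<open>Periodic, metabelian and extended residually finite groups\<close>

definition periodic_set :: "('a, 'b) monoid_scheme \<Rightarrow> 'a set \<Rightarrow> bool"
  where "periodic_set G S \<longleftrightarrow> (\<forall>x \<in> S. \<exists>n::nat. n > 0 \<and> x [^]\<^bsub>G\<^esub> n = \<one>\<^bsub>G\<^esub>)"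

definition metabelian :: "('a, 'b) monoid_scheme \<Rightarrow> bool"
  where "metabelian G \<longleftrightarrow> group G \<and> comm_group (G\<lparr>carrier := derived G (carrier G)\<rparr>)"

definition finite_index_subgroup :: "'a set \<Rightarrow> ('a, 'b) monoid_scheme \<Rightarrow> bool"
  where "finite_index_subgroup K G \<longleftrightarrow> subgroup K G \<and> finite (rcosets\<^bsub>G\<^esub> K)"

text \<open>The family is required to be nonempty because \<open>\<Inter> {}\<close> is the whole type rather than
  \<open>carrier G\<close>; nothing is lost, since \<open>carrier G\<close> itself has finite index.\<close>

definition ERF_group :: "('a, 'b) monoid_scheme \<Rightarrow> bool"
  where "ERF_group G \<longleftrightarrow> group G \<and>
    (\<forall>H. subgroup H G \<longrightarrow>
      (\<exists>\<F>. \<F> \<noteq> {} \<and> (\<forall>K \<in> \<F>. finite_index_subgroup K G) \<and> H = \<Inter> \<F>))"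

end

theory Submission
  imports Defs "HOL-Number_Theory.Cong"
begin

text \<open>
  Let \<open>p\<^sub>1, p\<^sub>2, \<dots>\<close> be distinct primes, and let \<open>P\<^sub>i\<close> be the group of affine maps \<open>z \<mapsto> u z + b\<close> on the
  integers modulo \<open>p\<^sub>i\<^sup>i\<close> with \<open>u \<equiv> 1\<close> modulo \<open>p\<^sub>i\<close>.  It is a finite \<open>p\<^sub>i\<close>-group, hence nilpotent, and its
  translations form an abelian subgroup \<open>B\<^sub>i\<close> that contains all commutators.  The witness \<open>G\<close> is
  generated, inside \<open>\<int> \<times> \<Prod>\<^sub>i P\<^sub>i\<close>, by the direct sum \<open>T\<close> of the \<open>P\<^sub>i\<close> and the element \<open>x\<close> whose
  coordinates are \<open>1\<close> and the translations by \<open>1\<close>.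

  Engel elements.  Elements of \<open>T\<close> have finite support, so they lie in a nilpotent direct factor of \<open>G\<close>
  and \<open>T \<subseteq> Z\<^sub>\<omega>(G)\<close>, which consists of bounded right Engel elements.  Conversely, an element outside \<open>T\<close>
  agrees in almost all coordinates with some \<open>x\<^sup>n\<close>, \<open>n \<noteq> 0\<close>.  Commuting \<open>m\<close> times with the inverse of
  multiplication by \<open>1 + p\<^sub>i\<close> turns translation by \<open>n\<close> into translation by \<open>p\<^sub>i\<^sup>m n\<close>, which is nontrivial
  when \<open>m < i\<close> and \<open>p\<^sub>i\<close> does not divide \<open>n\<close>; so the element is not bounded
  (\<open>bounded_right_engel_subset_T\<close>, \<open>translation_not_bounded_engel\<close>).  As \<open>G/T\<close> is cyclic, \<open>G = Z\<^sub>\<omega>\<^sub>+\<^sub>1(G)\<close>,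
  and one commutation leads from \<open>G\<close> into \<open>T\<close>, so all elements of \<open>G\<close> are right Engel.

  Conjugacy.  The normal closure of an element of \<open>G\<close> has all but finitely many coordinates in the
  abelian groups \<open>B\<^sub>i\<close>, where commutators also lie.  So the factor group of \<open>G\<close> by
  the centralizer of this closure has a centre of finite index, in particular finite conjugacy classes
  (\<open>FC2_G\<close>).  This is why \<open>x\<close> is built from translations: if its coordinates were the multiplications by
  \<open>1 + p\<^sub>i\<close>, then \<open>[x,P\<^sub>i]\<close> would not centralize \<open>x\<close> for large \<open>i\<close>, and \<open>x\<close> would have infinitely many
  conjugates modulo \<open>C\<^sub>G(x\<^sup>G)\<close>.

  Residual finiteness.  A subgroup \<open>H\<close> is the intersection of the preimages of its images in the finite
  groups \<open>P\<^sub>i \<times> \<int>/M\<close> (\<open>ERF_G\<close>).  This rests on the coprimality of the orders of the \<open>P\<^sub>i\<close>, by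
  which subgroups of \<open>T\<close> are direct sums of subgroups of the \<open>P\<^sub>i\<close> (\<open>T_mem_if_coordinates\<close>).\<close>

section \<open>Commutators, central series and factor groups\<close>

lemma (in group) commutator_eq:
  assumes "x \<in> carrier G" "y \<in> carrier G"
  shows "commutator G x y = inv (y \<otimes> x) \<otimes> (x \<otimes> y)"
  using assms by (simp add: commutator_def conjug_def inv_mult_group m_assoc)

lemma (in group) commutator_closed [simp]:
  "x \<in> carrier G \<Longrightarrow> y \<in> carrier G \<Longrightarrow> commutator G x y \<in> carrier G"
  by (simp add: commutator_def conjug_def)

lemma (in group) iter_commutator_closed [simp]:
  "x \<in> carrier G \<Longrightarrow> y \<in> carrier G \<Longrightarrow> iter_commutator G x m y \<in> carrier G"
  by (induction m) auto

lemma (in group) commutator_one [simp]: "y \<in> carrier G \<Longrightarrow> commutator G \<one> y = \<one>"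
  by (simp add: commutator_def conjug_def)

lemma (in group) iter_commutator_Suc_left:
  "iter_commutator G x (Suc m) y = iter_commutator G (commutator G x y) m y"
  by (induction m) auto

lemma (in group) normal_conj:
  assumes "N \<lhd> G" "h \<in> N" "x \<in> carrier G"
  shows "x \<otimes> h \<otimes> inv x \<in> N" "inv x \<otimes> h \<otimes> x \<in> N"
  using assms normal_inv_iff[of N] by (blast, metis inv_closed inv_inv)

lemma (in normal) rcos_eq_iff:
  assumes "x \<in> carrier G" "y \<in> carrier G"
  shows "H #> x = H #> y \<longleftrightarrow> inv x \<otimes> y \<in> H"
proof -
  have "H #> x = H #> y \<longleftrightarrow> y \<otimes> inv x \<in> H"
    by (metis assms is_group rcos_module repr_independence rcos_self subgroup_axioms)
  also have "\<dots> \<longleftrightarrow> inv x \<otimes> y \<in> H"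
  proof
    assume "y \<otimes> inv x \<in> H"
    from normal_conj(2)[OF normal_axioms this, of x] show "inv x \<otimes> y \<in> H"
      using assms by (simp add: m_assoc)
  next
    assume "inv x \<otimes> y \<in> H"
    from normal_conj(1)[OF normal_axioms this, of x] show "y \<otimes> inv x \<in> H"
      using assms by (simp add: m_assoc[symmetric])
  qed
  finally show ?thesis .
qed

text \<open>Modulo \<open>H\<close>, the elements \<open>g\<close> and \<open>y\<close> commute exactly when \<open>[g,y] \<in> H\<close>, because \<open>g y = y g [g,y]\<close>.\<close>

lemma (in normal) center_above_iff:
  "g \<in> center_above G H \<longleftrightarrow> g \<in> carrier G \<and> (\<forall>y\<in>carrier G. commutator G g y \<in> H)"
proof -
  have "(H #> g) <#> (H #> y) = (H #> y) <#> (H #> g) \<longleftrightarrow> commutator G g y \<in> H"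
    if "g \<in> carrier G" "y \<in> carrier G" for y
    using that by (metis commutator_eq m_closed rcos_eq_iff rcos_sum)
  then show ?thesis
    by (auto simp: center_above_def group_center_def centralizer_def FactGroup_def RCOSETS_def)
qed

text \<open>Conjugating a relation \<open>h t = t h\<close> by \<open>x\<close> gives one between \<open>x h x\<inverse>\<close> and \<open>x t x\<inverse>\<close>, and \<open>t\<close> may be chosen
  with \<open>x t x\<inverse> = s\<close>.  This is what makes the factor groups in the definition of \<open>FC\<^sup>n\<close> groups.\<close>

lemma (in group) centralizer_normal:
  assumes S: "S \<subseteq> carrier G"
    and conj: "\<And>g s. g \<in> carrier G \<Longrightarrow> s \<in> S \<Longrightarrow> inv g \<otimes> s \<otimes> g \<in> S"
  shows "centralizer G S \<lhd> G"
proof -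
  have sub: "subgroup (centralizer G S) G"
  proof
    show "centralizer G S \<subseteq> carrier G" "\<one> \<in> centralizer G S"
      using S by (auto simp: centralizer_def)
    fix a b assume a: "a \<in> centralizer G S" and b: "b \<in> centralizer G S"
    have "a \<otimes> b \<otimes> s = s \<otimes> (a \<otimes> b)" if "s \<in> S" for s
    proof -
      have c: "a \<in> carrier G" "b \<in> carrier G" "s \<in> carrier G" "a \<otimes> s = s \<otimes> a" "b \<otimes> s = s \<otimes> b"
        using a b that S by (auto simp: centralizer_def)
      then show ?thesis by (metis m_assoc)
    qed
    then show "a \<otimes> b \<in> centralizer G S" using a b by (auto simp: centralizer_def)
    have "inv a \<otimes> s = s \<otimes> inv a" if "s \<in> S" for s
    proof -
      have "a \<in> carrier G" "s \<in> carrier G" "a \<otimes> s = s \<otimes> a"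
        using a that S by (auto simp: centralizer_def)
      then show ?thesis by (metis inv_closed inv_solve_left inv_solve_right m_assoc m_closed)
    qed
    then show "inv a \<in> centralizer G S" using a by (auto simp: centralizer_def)
  qed
  moreover have "x \<otimes> h \<otimes> inv x \<in> centralizer G S"
    if x: "x \<in> carrier G" and h: "h \<in> centralizer G S" for x h
  proof -
    have hc: "h \<in> carrier G" using h by (simp add: centralizer_def)
    have "x \<otimes> h \<otimes> inv x \<otimes> s = s \<otimes> (x \<otimes> h \<otimes> inv x)" if s: "s \<in> S" for s
    proof -
      have sc: "s \<in> carrier G" using s S by blast
      have e: "h \<otimes> (inv x \<otimes> s \<otimes> x) = (inv x \<otimes> s \<otimes> x) \<otimes> h"
        using conj[OF x s] h by (simp add: centralizer_def)
      have "x \<otimes> h \<otimes> inv x \<otimes> s = x \<otimes> (h \<otimes> (inv x \<otimes> s \<otimes> x)) \<otimes> inv x"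
        using x hc sc by (simp add: m_assoc)
      also have "\<dots> = s \<otimes> (x \<otimes> h \<otimes> inv x)"
        unfolding e using x hc sc by (simp add: m_assoc[symmetric])
      finally show ?thesis .
    qed
    then show ?thesis using x hc by (simp add: centralizer_def)
  qed
  ultimately show ?thesis by (simp add: normal_inv_iff)
qed

text \<open>It is the preimage of the centre of the factor group, which is the centralizer of everything.\<close>

lemma (in normal) center_above_normal: "center_above G H \<lhd> G"
proof -
  interpret Q: group "G Mod H" by (rule factorgroup_is_group)
  have Qc: "carrier (G Mod H) = (\<lambda>x. H #> x) ` carrier G"
    by (auto simp: FactGroup_def RCOSETS_def)
  interpret h: group_hom G "G Mod H" "\<lambda>x. H #> x"
    using r_coset_hom_Mod by (simp add: group_hom_axioms_def group_hom_def Q.is_group is_group)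
  have Z: "group_center (G Mod H) \<lhd> (G Mod H)"
    unfolding group_center_def by (rule Q.centralizer_normal) (auto simp del: mult_FactGroup)
  show ?thesis
    unfolding normal_inv_iff
  proof (intro conjI ballI)
    show "subgroup (center_above G H) G"
    proof
      show "center_above G H \<subseteq> carrier G" by (auto simp: center_above_def)
      show "\<one> \<in> center_above G H"
        using subgroup.one_closed[OF normal_imp_subgroup[OF Z]] h.hom_one by (simp add: center_above_def)
      fix a b assume "a \<in> center_above G H" "b \<in> center_above G H"
      then show "a \<otimes> b \<in> center_above G H"
        using subgroup.m_closed[OF normal_imp_subgroup[OF Z], of "H #> a" "H #> b"] h.hom_mult[of a b]
        by (simp add: center_above_def)
    next
      fix a assume "a \<in> center_above G H"
      then show "inv a \<in> center_above G H"
        using subgroup.m_inv_closed[OF normal_imp_subgroup[OF Z], of "H #> a"] h.hom_inv[of a]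
        by (simp add: center_above_def)
    qed
    fix x g assume "x \<in> carrier G" "g \<in> center_above G H"
    then show "x \<otimes> g \<otimes> inv x \<in> center_above G H"
      using Q.normal_conj(1)[OF Z, of "H #> g" "H #> x"]
      by (simp add: center_above_def Qc h.hom_mult h.hom_inv del: mult_FactGroup)
  qed
qed

lemma (in group) upper_central_normal: "upper_central G k \<lhd> G"
proof (induction k)
  case 0
  then show ?case by (simp add: one_is_normal)
next
  case (Suc k)
  then show ?case by (simp add: normal.center_above_normal)
qed

lemma (in group) upper_central_Suc_iff:
  "g \<in> upper_central G (Suc k) \<longleftrightarrow>
     g \<in> carrier G \<and> (\<forall>y\<in>carrier G. commutator G g y \<in> upper_central G k)"
  by (simp add: normal.center_above_iff[OF upper_central_normal])

lemma (in group) upper_central_subset: "upper_central G k \<subseteq> carrier G"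
  using upper_central_normal normal_imp_subgroup subgroup.subset by blast

lemma (in group) commutator_in_normal:
  assumes "N \<lhd> G" "x \<in> N" "y \<in> carrier G"
  shows "commutator G x y \<in> N"
proof -
  interpret N: normal N G by fact
  show ?thesis
    unfolding commutator_def conjug_def
    by (intro N.m_closed N.m_inv_closed normal_conj(2) assms)
qed

lemma (in group) upper_central_mono:
  assumes "j \<le> k"
  shows "upper_central G j \<subseteq> upper_central G k"
proof -
  have step: "upper_central G n \<subseteq> upper_central G (Suc n)" for n
  proof
    fix x assume x: "x \<in> upper_central G n"
    then show "x \<in> upper_central G (Suc n)"
      unfolding upper_central_Suc_iff
      using commutator_in_normal[OF upper_central_normal x] upper_central_subset by blast
  qed
  show ?thesis using lift_Suc_mono_le[of "upper_central G", OF step assms] .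
qed

text \<open>The upper central series ascends at least as fast as any central series; this bounds the nilpotency
  class of the finite factors below without computing their upper central series.\<close>

lemma (in group) central_series_subset_upper_central:
  assumes D0: "D 0 \<subseteq> {\<one>}" and Dc: "\<And>j. D j \<subseteq> carrier G"
    and D: "\<And>j x y. x \<in> D (Suc j) \<Longrightarrow> y \<in> carrier G \<Longrightarrow> commutator G x y \<in> D j"
  shows "D j \<subseteq> upper_central G j"
proof (induction j)
  case 0
  then show ?case using D0 by simp
next
  case (Suc j)
  show ?case
  proof
    fix x assume x: "x \<in> D (Suc j)"
    then show "x \<in> upper_central G (Suc j)"
      unfolding upper_central_Suc_iff using D[OF x] Dc Suc by blast
  qed
qed

lemma (in group) iter_commutator_upper_central:
  "x \<in> upper_central G k \<Longrightarrow> y \<in> carrier G \<Longrightarrow> iter_commutator G x k y = \<one>"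
proof (induction k arbitrary: x)
  case (Suc k)
  from Suc.prems have "commutator G x y \<in> upper_central G k"
    unfolding upper_central_Suc_iff by blast
  from Suc.IH[OF this Suc.prems(2)] show ?case
    by (subst iter_commutator_Suc_left)
qed simp

text \<open>Each commutation with \<open>g\<close> descends one step in the upper central series, whatever \<open>g\<close> is.\<close>

lemma (in group) upper_central_omega_subset_bounded_right_engel:
  "upper_central_omega G \<subseteq> bounded_right_engel G"
proof
  fix x assume "x \<in> upper_central_omega G"
  then obtain k where k: "x \<in> upper_central G k" by (auto simp: upper_central_omega_def)
  then have x: "x \<in> upper_central G (Suc k)" using upper_central_mono[of k "Suc k"] by auto
  have "x \<in> carrier G" using k upper_central_subset by blast
  then show "x \<in> bounded_right_engel G"
    unfolding bounded_right_engel_def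
    using iter_commutator_upper_central[OF x] by (auto intro!: exI[of _ "Suc k"])
qed

section \<open>Finite index, \<open>FC\<^sup>2\<close>-groups and \<open>ERF\<close>-groups\<close>

text \<open>Finite index always comes from a map into a finite set that
  separates cosets, typically the restriction of a family to finitely many coordinates.\<close>

lemma (in group) finite_rcosetsI:
  assumes K: "subgroup K G" and fin: "finite (\<phi> ` carrier G)"
    and sep: "\<And>g h. g \<in> carrier G \<Longrightarrow> h \<in> carrier G \<Longrightarrow> \<phi> g = \<phi> h \<Longrightarrow> g \<otimes> inv h \<in> K"
  shows "finite (rcosets K)"
proof -
  define r where "r v = (SOME g. g \<in> carrier G \<and> \<phi> g = v)" for v
  have "K #> g = K #> r (\<phi> g)" if g: "g \<in> carrier G" for g
  proof -
    have r: "r (\<phi> g) \<in> carrier G" "\<phi> (r (\<phi> g)) = \<phi> g"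
      using someI[of "\<lambda>h. h \<in> carrier G \<and> \<phi> h = \<phi> g" g] g by (auto simp: r_def)
    then have "g \<otimes> inv r (\<phi> g) \<in> K" using sep g by simp
    then have "g \<in> K #> r (\<phi> g)"
      using subgroup.rcos_module[OF K is_group] g r by simp
    then show ?thesis using repr_independence r K by simp
  qed
  then have "rcosets K \<subseteq> (\<lambda>v. K #> r v) ` (\<phi> ` carrier G)" by (auto simp: RCOSETS_def)
  then show ?thesis using fin finite_surj by blast
qed

lemma (in group) centralizer_normal_closure_normal:
  assumes x: "x \<in> carrier G"
  shows "normal_closure G (generate G {x}) \<subseteq> carrier G"
    and "centralizer G (normal_closure G (generate G {x})) \<lhd> G"
proof -
  have "carrier G \<lhd> G" by (simp add: normal_inv_iff subgroup_self)
  then show c: "normal_closure G (generate G {x}) \<subseteq> carrier G"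
    unfolding normal_closure_def using generate_incl[of "{x}"] x by blast
  show "centralizer G (normal_closure G (generate G {x})) \<lhd> G"
    using c by (rule centralizer_normal) (auto simp: normal_closure_def intro: normal_conj(2))
qed

lemma (in group) normal_closure_subset:
  assumes "N \<lhd> G" "x \<in> N"
  shows "normal_closure G (generate G {x}) \<subseteq> N"
proof -
  have "generate G {x} \<subseteq> N"
    using assms by (intro generate_subgroup_incl normal_imp_subgroup) auto
  then show ?thesis using assms(1) by (auto simp: normal_closure_def)
qed

text \<open>A group whose centre has finite index is an \<open>FC\<close>-group, since the centralizer of any subset contains
  the centre.  The hypothesis states that the centre of \<open>G/H\<close> has finite index, in terms of \<open>G\<close>.\<close>

lemma (in normal) FC1_group_FactGroup:
  assumes fin: "finite (\<phi> ` carrier G)"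
    and sep: "\<And>g h. g \<in> carrier G \<Longrightarrow> h \<in> carrier G \<Longrightarrow> \<phi> g = \<phi> h \<Longrightarrow> g \<otimes> inv h \<in> center_above G H"
  shows "FC1_group (G Mod H)"
proof -
  interpret Q: group "G Mod H" by (rule factorgroup_is_group)
  have Qc: "carrier (G Mod H) = (\<lambda>x. H #> x) ` carrier G"
    by (auto simp: FactGroup_def RCOSETS_def)
  interpret h: group_hom G "G Mod H" "\<lambda>x. H #> x"
    using r_coset_hom_Mod by (simp add: group_hom_axioms_def group_hom_def Q.is_group is_group)
  define r where "r A = (SOME g. g \<in> carrier G \<and> A = H #> g)" for A
  have r: "r A \<in> carrier G" "A = H #> r A" if "A \<in> carrier (G Mod H)" for A
  proof -
    have "r A \<in> carrier G \<and> A = H #> r A"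
      unfolding r_def by (rule someI_ex) (use that Qc in auto)
    then show "r A \<in> carrier G" "A = H #> r A" by auto
  qed
  have "FC0_group (G Mod H Mod centralizer (G Mod H) (normal_closure (G Mod H) (generate (G Mod H) {Y})))"
    if Y: "Y \<in> carrier (G Mod H)" for Y
  proof -
    let ?N = "normal_closure (G Mod H) (generate (G Mod H) {Y})"
    note CN = Q.centralizer_normal_closure_normal[OF Y]
    have "finite (rcosets\<^bsub>G Mod H\<^esub> (centralizer (G Mod H) ?N))"
    proof (rule Q.finite_rcosetsI[where \<phi> = "\<lambda>A. \<phi> (r A)"])
      show "subgroup (centralizer (G Mod H) ?N) (G Mod H)" using CN(2) by (rule normal_imp_subgroup)
      show "finite ((\<lambda>A. \<phi> (r A)) ` carrier (G Mod H))"
        by (rule finite_subset[OF _ fin]) (use r in auto)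
      fix A B assume AB: "A \<in> carrier (G Mod H)" "B \<in> carrier (G Mod H)" "\<phi> (r A) = \<phi> (r B)"
      have "H #> (r A \<otimes> inv r B) \<in> group_center (G Mod H)"
        using sep[of "r A" "r B"] AB r by (auto simp: center_above_def)
      moreover have "H #> (r A \<otimes> inv r B) = A \<otimes>\<^bsub>G Mod H\<^esub> inv\<^bsub>G Mod H\<^esub> B"
        using r AB h.hom_mult[of "r A" "inv r B"] h.hom_inv[of "r B"] by simp
      ultimately show "A \<otimes>\<^bsub>G Mod H\<^esub> inv\<^bsub>G Mod H\<^esub> B \<in> centralizer (G Mod H) ?N"
        using CN(1) by (auto simp: group_center_def centralizer_def)
    qed
    then show ?thesis
      unfolding FC0_group_def using normal.factorgroup_is_group[OF CN(2)] by (simp add: FactGroup_def)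
  qed
  then show ?thesis by (simp add: FC1_group_def FC_step_def Q.is_group)
qed

text \<open>For \<open>FC\<^sup>2\<close> it thus suffices that each factor group \<open>G/C\<^sub>G(x\<^sup>G)\<close> has a centre of finite index.\<close>

lemma (in group) FC2_groupI:
  assumes fin: "\<And>x. x \<in> carrier G \<Longrightarrow> finite (\<phi> x ` carrier G)"
    and sep: "\<And>x g h k. x \<in> carrier G \<Longrightarrow> g \<in> carrier G \<Longrightarrow> h \<in> carrier G \<Longrightarrow> \<phi> x g = \<phi> x h \<Longrightarrow>
      k \<in> carrier G \<Longrightarrow>
      commutator G (g \<otimes> inv h) k \<in> centralizer G (normal_closure G (generate G {x}))"
  shows "FC2_group G"
  unfolding FC2_group_def FC_step_def
proof (intro conjI ballI is_group)
  fix x assume x: "x \<in> carrier G"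
  interpret C: normal "centralizer G (normal_closure G (generate G {x}))" G
    using x by (rule centralizer_normal_closure_normal)
  show "FC1_group (G Mod centralizer G (normal_closure G (generate G {x})))"
    by (rule C.FC1_group_FactGroup[OF fin[OF x]]) (use sep[OF x] C.center_above_iff in auto)
qed

lemma (in group) ERF_groupI:
  assumes "\<And>H g. subgroup H G \<Longrightarrow> g \<in> carrier G \<Longrightarrow> g \<notin> H \<Longrightarrow>
    \<exists>K. finite_index_subgroup K G \<and> H \<subseteq> K \<and> g \<notin> K"
  shows "ERF_group G"
  unfolding ERF_group_def
proof (intro conjI is_group allI impI)
  fix H assume H: "subgroup H G"
  let ?F = "{K. finite_index_subgroup K G \<and> H \<subseteq> K}"
  have "finite (rcosets (carrier G))"
    by (rule finite_rcosetsI[where \<phi> = "\<lambda>_. ()"]) (auto simp: subgroup_self)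
  then have G: "carrier G \<in> ?F"
    using subgroup.subset[OF H] by (simp add: finite_index_subgroup_def subgroup_self)
  moreover have "H = \<Inter> ?F"
  proof
    show "\<Inter> ?F \<subseteq> H" using assms[OF H] G by blast
  qed blast
  ultimately show "\<exists>\<F>. \<F> \<noteq> {} \<and> (\<forall>K\<in>\<F>. finite_index_subgroup K G) \<and> H = \<Inter> \<F>"
    by (intro exI[of _ ?F]) blast
qed

section \<open>Adjoining a diagonal element to a direct sum of finite nilpotent groups\<close>

text \<open>Coordinate \<open>0\<close> is a copy of the integers that records the exponent of the adjoined element, so
  that this element has infinite order and the exponent can be read off.  The diagonal element is
  \<open>x = (d i 1)\<^sub>i\<close>, whose powers are \<open>x\<^sup>n = (d i n)\<^sub>i\<close>; its coordinates lie in the abelian groups \<open>B i\<close>, which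
  contain the derived groups of the factors, yet their Engel degrees tend to infinity.\<close>

locale diagonal_extension =
  fixes P :: "nat \<Rightarrow> int monoid" and B :: "nat \<Rightarrow> int set" and d :: "nat \<Rightarrow> int \<Rightarrow> int"
  assumes P_group: "group (P i)"
    and P0: "P 0 = integer_group"
    and P_finite: "i > 0 \<Longrightarrow> finite (carrier (P i))"
    and P_coprime: "i > 0 \<Longrightarrow> j > 0 \<Longrightarrow> i \<noteq> j \<Longrightarrow> coprime (order (P i)) (order (P j))"
    and P_nilpotent: "\<exists>c. upper_central (P i) c = carrier (P i)"
    and B_subgroup: "subgroup (B i) (P i)"
    and B_comm: "x \<in> B i \<Longrightarrow> y \<in> B i \<Longrightarrow> x \<otimes>\<^bsub>P i\<^esub> y = y \<otimes>\<^bsub>P i\<^esub> x"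
    and B_commutator: "x \<in> carrier (P i) \<Longrightarrow> y \<in> carrier (P i) \<Longrightarrow> commutator (P i) x y \<in> B i"
    and d_hom: "d i \<in> hom integer_group (P i)"
    and d_0: "d 0 n = n"
    and d_B: "d i n \<in> B i"
    and d_unbounded: "n \<noteq> 0 \<Longrightarrow>
      \<exists>N. \<forall>i\<ge>N. \<exists>g\<in>carrier (P i). iter_commutator (P i) (d i n) m g \<noteq> \<one>\<^bsub>P i\<^esub>"
begin

text \<open>The group generated by \<open>x\<close> and the direct sum of the factors \<open>P i\<close> with \<open>i > 0\<close>, inside the full
  direct product.\<close>

definition G :: "(nat \<Rightarrow> int) monoid" where
  "G = \<lparr>carrier = {f. (\<forall>i. f i \<in> carrier (P i)) \<and> finite {i. f i \<noteq> d i (f 0)}},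
        monoid.mult = (\<lambda>f g i. f i \<otimes>\<^bsub>P i\<^esub> g i), one = (\<lambda>i. \<one>\<^bsub>P i\<^esub>)\<rparr>"

lemma mult_G [simp]: "f \<otimes>\<^bsub>G\<^esub> g = (\<lambda>i. f i \<otimes>\<^bsub>P i\<^esub> g i)"
  by (simp add: G_def)

lemma one_G [simp]: "\<one>\<^bsub>G\<^esub> = (\<lambda>i. \<one>\<^bsub>P i\<^esub>)"
  by (simp add: G_def)

lemma carrier_G: "f \<in> carrier G \<longleftrightarrow> (\<forall>i. f i \<in> carrier (P i)) \<and> finite {i. f i \<noteq> d i (f 0)}"
  by (simp add: G_def)

lemma coord_closed [simp, intro]: "f \<in> carrier G \<Longrightarrow> f i \<in> carrier (P i)"
  by (simp add: carrier_G)

interpretation P: group "P i" for i by (rule P_group)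

interpretation d: group_hom integer_group "P i" "d i" for i
  using d_hom by (simp add: group_hom_def group_hom_axioms_def P_group)

lemma d_simps [simp]:
  "d i n \<in> carrier (P i)" "d i 0 = \<one>\<^bsub>P i\<^esub>"
  "d i (m + n) = d i m \<otimes>\<^bsub>P i\<^esub> d i n" "d i (- n) = inv\<^bsub>P i\<^esub> d i n"
  using d.hom_closed[of n i] d.hom_one[of i] d.hom_mult[of m n i] d.hom_inv[of n i] by auto

lemma coord_0 [simp]: "x \<otimes>\<^bsub>P 0\<^esub> y = x + y" "\<one>\<^bsub>P 0\<^esub> = 0" "inv\<^bsub>P 0\<^esub> x = - x"
    "commutator (P 0) x y = 0" "carrier (P 0) = UNIV"
  by (simp_all add: P0 commutator_def conjug_def)

lemma inverse_closed:
  assumes "f \<in> carrier G"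
  shows "(\<lambda>i. inv\<^bsub>P i\<^esub> f i) \<in> carrier G"
proof -
  have "{i. inv\<^bsub>P i\<^esub> f i \<noteq> d i (- f 0)} \<subseteq> {i. f i \<noteq> d i (f 0)}" by auto
  then show ?thesis using assms by (auto simp: carrier_G intro: finite_subset)
qed

lemma group_G: "group G"
proof (rule groupI)
  show "\<one>\<^bsub>G\<^esub> \<in> carrier G" by (simp add: carrier_G)
  fix f g assume f: "f \<in> carrier G" and g: "g \<in> carrier G"
  have "{i. f i \<otimes>\<^bsub>P i\<^esub> g i \<noteq> d i (f 0 + g 0)} \<subseteq> {i. f i \<noteq> d i (f 0)} \<union> {i. g i \<noteq> d i (g 0)}"
    by auto
  then show "f \<otimes>\<^bsub>G\<^esub> g \<in> carrier G"
    using f g unfolding carrier_G by (auto intro: finite_subset)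
next
  fix f assume "f \<in> carrier G"
  then show "\<exists>g\<in>carrier G. g \<otimes>\<^bsub>G\<^esub> f = \<one>\<^bsub>G\<^esub>"
    by (intro bexI[OF _ inverse_closed[of f]]) auto
qed (auto simp: P.m_assoc)

interpretation G: group G by (rule group_G)

lemma inv_G [simp]: "f \<in> carrier G \<Longrightarrow> inv\<^bsub>G\<^esub> f = (\<lambda>i. inv\<^bsub>P i\<^esub> f i)"
  by (rule G.inv_equality) (auto simp: inverse_closed)

lemma commutator_G [simp]:
  "f \<in> carrier G \<Longrightarrow> g \<in> carrier G \<Longrightarrow> commutator G f g = (\<lambda>i. commutator (P i) (f i) (g i))"
  by (simp add: commutator_def conjug_def)

lemma iter_commutator_G:
  "f \<in> carrier G \<Longrightarrow> g \<in> carrier G \<Longrightarrow>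
     iter_commutator G f m g i = iter_commutator (P i) (f i) m (g i)"
  by (induction m arbitrary: i) auto

lemma pow_G: "f \<in> carrier G \<Longrightarrow> (f [^]\<^bsub>G\<^esub> (n::nat)) i = f i [^]\<^bsub>P i\<^esub> n"
  by (induction n arbitrary: i) auto

lemma int_pow_G:
  assumes "f \<in> carrier G"
  shows "(f [^]\<^bsub>G\<^esub> (k::int)) i = f i [^]\<^bsub>P i\<^esub> k"
proof -
  have "(\<lambda>f. f i) \<in> hom G (P i)" by (auto simp: hom_def)
  from hom_int_pow[OF this assms group_G P_group] show ?thesis .
qed

lemma int_pow_order:
  assumes "x \<in> carrier (P i)" "int (order (P i)) dvd k"
  shows "x [^]\<^bsub>P i\<^esub> k = \<one>\<^bsub>P i\<^esub>"
  unfolding P.int_pow_eq_id[OF assms(1)]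
  using P.ord_dvd_group_order[OF assms(1)] assms(2) by (meson dvd_trans of_nat_dvd_iff)

definition part :: "nat set \<Rightarrow> (nat \<Rightarrow> int) \<Rightarrow> nat \<Rightarrow> int" where
  "part F f = (\<lambda>i. if i \<in> F then f i else \<one>\<^bsub>P i\<^esub>)"

lemma part_closed:
  assumes "finite F" "0 \<notin> F" "\<And>i. i \<in> F \<Longrightarrow> f i \<in> carrier (P i)"
  shows "part F f \<in> carrier G"
proof -
  have "{i. part F f i \<noteq> d i (part F f 0)} \<subseteq> F" using assms by (auto simp: part_def)
  then show ?thesis using assms by (auto simp: carrier_G part_def intro: finite_subset)
qed

text \<open>The kernel of the projection to coordinate \<open>0\<close>, that is, the direct sum of the finite factors.  It
  turns out to be both \<open>Z\<^sub>\<omega>(G)\<close> and the set of bounded right Engel elements.\<close>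

definition T :: "(nat \<Rightarrow> int) set" where "T = {f \<in> carrier G. f 0 = 0}"

lemma T_support: "f \<in> T \<Longrightarrow> finite {i. f i \<noteq> \<one>\<^bsub>P i\<^esub>}"
  by (auto simp: T_def carrier_G)

lemma T_normal: "T \<lhd> G"
  unfolding G.normal_inv_iff
  by (auto simp: T_def intro!: G.subgroupI G.m_closed[simplified] inverse_closed)

lemma T_annihilator:
  assumes "f \<in> T"
  shows "\<exists>n>0. f [^]\<^bsub>G\<^esub> (n::nat) = \<one>\<^bsub>G\<^esub>"
proof -
  let ?S = "{i. f i \<noteq> \<one>\<^bsub>P i\<^esub>}"
  let ?n = "\<Prod>i\<in>?S. order (P i)"
  have f: "f \<in> carrier G" "f 0 = 0" using assms by (auto simp: T_def)
  have S0: "i > 0" if "i \<in> ?S" for i using that f by (cases "i = 0") auto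
  have "f i [^]\<^bsub>P i\<^esub> ?n = \<one>\<^bsub>P i\<^esub>" for i
  proof (cases "i \<in> ?S")
    case True
    then have "order (P i) dvd ?n" using T_support[OF assms] by (intro dvd_prodI)
    then obtain k where "?n = order (P i) * k" by blast
    then show ?thesis
      using f by (simp add: P.nat_pow_pow[symmetric] P.pow_order_eq_1)
  qed simp
  then have "f [^]\<^bsub>G\<^esub> ?n = \<one>\<^bsub>G\<^esub>" by (auto simp: pow_G[OF f(1)])
  moreover have "?n > 0"
    using S0 P_finite by (auto intro!: prod_pos simp: P.order_gt_0_iff_finite)
  ultimately show ?thesis by blast
qed

lemma upper_central_G:
  "f \<in> carrier G \<Longrightarrow> (\<And>i. f i \<in> upper_central (P i) k) \<Longrightarrow> f \<in> upper_central G k"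
proof (induction k arbitrary: f)
  case (Suc k)
  have "commutator G f g \<in> upper_central G k" if g: "g \<in> carrier G" for g
  proof (rule Suc.IH)
    show "commutator G f g \<in> carrier G" using Suc.prems g by (intro G.commutator_closed)
    show "commutator G f g i \<in> upper_central (P i) k" for i
      using Suc.prems(2)[of i] Suc.prems(1) g
      unfolding P.upper_central_Suc_iff by auto
  qed
  then show ?case using Suc.prems unfolding G.upper_central_Suc_iff by blast
qed auto

text \<open>An element of finite support lives in a product of finitely many nilpotent groups, whose classes are
  bounded; over all of \<open>T\<close> they need not be.\<close>

lemma T_subset_omega: "T \<subseteq> upper_central_omega G"
proof
  fix f assume f: "f \<in> T"
  obtain c where c: "\<And>i. upper_central (P i) (c i) = carrier (P i)" using P_nilpotent by metis
  let ?S = "{i. f i \<noteq> \<one>\<^bsub>P i\<^esub>}"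
  let ?k = "Max (insert 0 (c ` ?S))"
  have fG: "f \<in> carrier G" using f by (simp add: T_def)
  have "f i \<in> upper_central (P i) ?k" for i
  proof (cases "i \<in> ?S")
    case True
    then have "c i \<le> ?k" using T_support[OF f] by (intro Max_ge) auto
    then show ?thesis using P.upper_central_mono c fG by blast
  next
    case False
    then show ?thesis
      using subgroup.one_closed[OF normal_imp_subgroup[OF P.upper_central_normal]] by simp
  qed
  then show "f \<in> upper_central_omega G"
    using upper_central_G fG unfolding upper_central_omega_def by blast
qed

text \<open>An element outside \<open>T\<close> agrees with some \<open>x\<^sup>n\<close>, \<open>n \<noteq> 0\<close>, in almost all coordinates.  In late coordinates
  \<open>x\<^sup>n\<close> needs arbitrarily many commutations with a suitable element of the factor to vanish.\<close>

lemma bounded_right_engel_subset_T: "bounded_right_engel G \<subseteq> T"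
proof
  fix f assume "f \<in> bounded_right_engel G"
  then obtain m where f: "f \<in> carrier G"
    and m: "\<And>g. g \<in> carrier G \<Longrightarrow> iter_commutator G f m g = \<one>\<^bsub>G\<^esub>"
    by (auto simp: bounded_right_engel_def)
  show "f \<in> T"
  proof (rule ccontr)
    assume "f \<notin> T"
    then have "f 0 \<noteq> 0" using f by (simp add: T_def)
    from d_unbounded[OF this, of m] obtain N where N: "\<And>i. i \<ge> N \<Longrightarrow>
      \<exists>g\<in>carrier (P i). iter_commutator (P i) (d i (f 0)) m g \<noteq> \<one>\<^bsub>P i\<^esub>" by blast
    have "finite ({i. f i \<noteq> d i (f 0)} \<union> {..N})" using f by (simp add: carrier_G)
    then obtain i where "i \<notin> {i. f i \<noteq> d i (f 0)} \<union> {..N}"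
      using ex_new_if_finite infinite_UNIV_nat by blast
    then have i: "f i = d i (f 0)" "i > N" by auto
    obtain g where g: "g \<in> carrier (P i)" "iter_commutator (P i) (f i) m g \<noteq> \<one>\<^bsub>P i\<^esub>"
      using N[of i] i by auto
    have "part {i} (\<lambda>_. g) \<in> carrier G" using g i by (intro part_closed) auto
    with m[of "part {i} (\<lambda>_. g)"] iter_commutator_G[OF f, of "part {i} (\<lambda>_. g)" m i] g
    show False by (simp add: part_def)
  qed
qed

lemma omega_eq_T: "upper_central_omega G = T" and bounded_eq_T: "bounded_right_engel G = T"
  using T_subset_omega bounded_right_engel_subset_T G.upper_central_omega_subset_bounded_right_engel
  by blast+

lemma commutator_in_T: "f \<in> carrier G \<Longrightarrow> g \<in> carrier G \<Longrightarrow> commutator G f g \<in> T"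
  using G.commutator_closed[of f g] by (auto simp: T_def)

lemma omega_Suc: "upper_central_omega_Suc G = carrier G"
  using normal.center_above_iff[OF T_normal] commutator_in_T
  unfolding upper_central_omega_Suc_def omega_eq_T by blast

text \<open>One commutation leads from \<open>G\<close> into \<open>T\<close>, all of whose elements are bounded right Engel.\<close>

lemma right_engel_G: "right_engel G = carrier G"
proof -
  have "\<exists>m\<ge>1. iter_commutator G f m g = \<one>\<^bsub>G\<^esub>" if "f \<in> carrier G" "g \<in> carrier G" for f g
  proof -
    have "commutator G f g \<in> bounded_right_engel G"
      using commutator_in_T that bounded_eq_T by blast
    then obtain m where "iter_commutator G (commutator G f g) m g = \<one>\<^bsub>G\<^esub>"
      using \<open>g \<in> carrier G\<close> unfolding bounded_right_engel_def by blast
    then have "iter_commutator G f (Suc m) g = \<one>\<^bsub>G\<^esub>"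
      unfolding G.iter_commutator_Suc_left .
    then show ?thesis by (intro exI[of _ "Suc m"]) simp
  qed
  then show ?thesis by (auto simp: right_engel_def)
qed

lemma periodic_omega: "periodic_set G (upper_central_omega G)"
  using T_annihilator unfolding omega_eq_T periodic_set_def by blast

lemma not_periodic: "\<not> periodic_set G (carrier G)"
proof
  assume p: "periodic_set G (carrier G)"
  have x: "(\<lambda>i. d i 1) \<in> carrier G" by (simp add: carrier_G d_0)
  with p obtain n :: nat where "n > 0" "(\<lambda>i. d i 1) [^]\<^bsub>G\<^esub> n = \<one>\<^bsub>G\<^esub>"
    unfolding periodic_set_def by blast
  with pow_G[OF x, of n 0] show False by (simp add: d_0 P0)
qed

lemma B_conj:
  assumes "x \<in> carrier (P i)" "b \<in> B i"
  shows "x \<otimes>\<^bsub>P i\<^esub> b \<otimes>\<^bsub>P i\<^esub> inv\<^bsub>P i\<^esub> x \<in> B i"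
proof -
  have b: "b \<in> carrier (P i)" using assms B_subgroup subgroup.mem_carrier by metis
  have "b \<otimes>\<^bsub>P i\<^esub> commutator (P i) b (inv\<^bsub>P i\<^esub> x) \<in> B i"
    using assms b by (intro subgroup.m_closed[OF B_subgroup] B_commutator) auto
  then show ?thesis
    using assms b by (simp add: commutator_def conjug_def P.m_assoc[symmetric])
qed

text \<open>These normal subgroups enclose normal closures: if \<open>F\<close> is the set of coordinates in which \<open>f\<close> differs
  from the power of the diagonal element with the same exponent, then the normal closure of \<open>f\<close> lies in the subgroup belonging to \<open>F\<close>.\<close>

lemma off_normal: "{f \<in> carrier G. \<forall>i. i \<notin> F \<longrightarrow> f i \<in> B i} \<lhd> G"
  unfolding G.normal_inv_iff
  using subgroup.one_closed[OF B_subgroup] subgroup.m_closed[OF B_subgroup]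
    subgroup.m_inv_closed[OF B_subgroup] G.one_closed
  by (auto simp: B_conj intro!: G.subgroupI G.m_closed[simplified] inverse_closed)

lemma metabelian_G: "metabelian G"
proof -
  let ?B = "{f \<in> carrier G. \<forall>i. i \<notin> {} \<longrightarrow> f i \<in> B i}"
  have "derived G (carrier G) \<subseteq> ?B"
    unfolding derived_def
  proof (rule G.generate_subgroup_incl)
    show "subgroup ?B G" by (intro normal_imp_subgroup off_normal)
    show "(\<Union>h1\<in>carrier G. \<Union>h2\<in>carrier G. {h1 \<otimes>\<^bsub>G\<^esub> h2 \<otimes>\<^bsub>G\<^esub> inv\<^bsub>G\<^esub> h1 \<otimes>\<^bsub>G\<^esub> inv\<^bsub>G\<^esub> h2}) \<subseteq> ?B"
    proof clarify
      fix f g i assume f: "f \<in> carrier G" and g: "g \<in> carrier G"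
      have "f i \<otimes>\<^bsub>P i\<^esub> g i \<otimes>\<^bsub>P i\<^esub> inv\<^bsub>P i\<^esub> f i \<otimes>\<^bsub>P i\<^esub> inv\<^bsub>P i\<^esub> g i \<in> B i" for i
        using B_commutator[of "inv\<^bsub>P i\<^esub> f i" i "inv\<^bsub>P i\<^esub> g i"] f g
        by (simp add: commutator_def conjug_def P.m_assoc)
      moreover have "f \<otimes>\<^bsub>G\<^esub> g \<otimes>\<^bsub>G\<^esub> inv\<^bsub>G\<^esub> f \<otimes>\<^bsub>G\<^esub> inv\<^bsub>G\<^esub> g \<in> carrier G"
        using f g by (intro G.m_closed G.inv_closed)
      ultimately show "f \<otimes>\<^bsub>G\<^esub> g \<otimes>\<^bsub>G\<^esub> inv\<^bsub>G\<^esub> f \<otimes>\<^bsub>G\<^esub> inv\<^bsub>G\<^esub> g \<in> carrier G \<and>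
          (\<forall>i. i \<notin> {} \<longrightarrow> (f \<otimes>\<^bsub>G\<^esub> g \<otimes>\<^bsub>G\<^esub> inv\<^bsub>G\<^esub> f \<otimes>\<^bsub>G\<^esub> inv\<^bsub>G\<^esub> g) i \<in> B i)"
        using f g by simp
    qed
  qed
  then have dB: "f i \<in> B i" if "f \<in> derived G (carrier G)" for f i using that by blast
  have comm: "f \<otimes>\<^bsub>G\<^esub> g = g \<otimes>\<^bsub>G\<^esub> f"
    if "f \<in> derived G (carrier G)" "g \<in> derived G (carrier G)" for f g
    using B_comm[OF dB[OF that(1)] dB[OF that(2)]] by simp
  have "group (G\<lparr>carrier := derived G (carrier G)\<rparr>)"
    by (intro subgroup.subgroup_is_group G.derived_is_subgroup group_G) simp
  then have "comm_group (G\<lparr>carrier := derived G (carrier G)\<rparr>)"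
    by (rule group.group_comm_groupI) (use comm in simp)
  with group_G show ?thesis by (simp add: metabelian_def)
qed

text \<open>Let \<open>F\<close> be the finite set of coordinates in which \<open>x\<close> differs from the power of the diagonal element
  with the same exponent.  An element that is trivial
  on \<open>F\<close> has commutators that are trivial on \<open>F\<close> and lie in \<open>B i\<close> elsewhere.  Since \<open>x\<^sup>G\<close> also lies in
  the abelian \<open>B i\<close> outside \<open>F\<close>, these commutators centralize \<open>x\<^sup>G\<close>.  So the elements trivial on \<open>F\<close>,
  which form a subgroup of finite index, are central modulo \<open>C\<^sub>G(x\<^sup>G)\<close>.\<close>

lemma FC2_G: "FC2_group G"
proof (rule G.FC2_groupI)
  let ?F = "\<lambda>x. {i. x i \<noteq> d i (x 0)}"
  fix x assume x: "x \<in> carrier G"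
  have F: "finite (?F x)" "\<And>i. i \<in> ?F x \<Longrightarrow> i > 0" using x d_0
    by (auto simp: carrier_G intro!: Nat.gr0I)
  have "(\<lambda>g. restrict g (?F x)) ` carrier G \<subseteq> (\<Pi>\<^sub>E i\<in>?F x. carrier (P i))" by auto
  moreover have "finite (\<Pi>\<^sub>E i\<in>?F x. carrier (P i))"
    using F P_finite by (intro finite_PiE) auto
  ultimately show "finite ((\<lambda>g. restrict g (?F x)) ` carrier G)"
    by (rule finite_subset)
  fix g h k assume g: "g \<in> carrier G" and h: "h \<in> carrier G" and k: "k \<in> carrier G"
    and eq: "restrict g (?F x) = restrict h (?F x)"
  let ?c = "commutator G (g \<otimes>\<^bsub>G\<^esub> inv\<^bsub>G\<^esub> h) k"
  have c: "?c \<in> carrier G" using g h k by (intro G.commutator_closed G.m_closed G.inv_closed)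
  have gh: "g \<otimes>\<^bsub>G\<^esub> inv\<^bsub>G\<^esub> h \<in> carrier G" using g h by (intro G.m_closed G.inv_closed)
  have ci: "?c i = commutator (P i) (g i \<otimes>\<^bsub>P i\<^esub> inv\<^bsub>P i\<^esub> h i) (k i)" for i
    using gh g h k by simp
  have "?c i \<otimes>\<^bsub>P i\<^esub> s i = s i \<otimes>\<^bsub>P i\<^esub> ?c i"
    if s: "s \<in> normal_closure G (generate G {x})" for s i
  proof -
    have "x \<in> {f \<in> carrier G. \<forall>i. i \<notin> ?F x \<longrightarrow> f i \<in> B i}" using x d_B by auto
    from G.normal_closure_subset[OF off_normal this] s
    have sG: "s \<in> carrier G" and sB: "i \<notin> ?F x \<Longrightarrow> s i \<in> B i" by blast+
    show ?thesis
    proof (cases "i \<in> ?F x")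
      case True
      then have "g i = h i" using fun_cong[OF eq, of i] by (simp add: restrict_def)
      then show ?thesis using sG h k unfolding ci by simp
    next
      case False
      have "?c i \<in> B i" unfolding ci using g h k by (intro B_commutator) auto
      then show ?thesis using sB[OF False] by (rule B_comm)
    qed
  qed
  then show "?c \<in> centralizer G (normal_closure G (generate G {x}))"
    using c by (simp add: centralizer_def del: commutator_G)
qed

text \<open>The preimage of the image of \<open>H\<close> under the projection from \<open>G\<close> to the finite group \<open>P i \<times> \<int>/M\<close>.\<close>

lemma level_finite_index:
  assumes H: "subgroup H G" and i: "i > 0" and M: "M > 0"
  shows "finite_index_subgroup {f \<in> carrier G. \<exists>h\<in>H. f i = h i \<and> M dvd f 0 - h 0} G"
    (is "finite_index_subgroup ?K G")
proof -
  interpret H: subgroup H G by (rule H)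
  have K: "subgroup ?K G"
  proof (rule G.subgroupI)
    show "?K \<noteq> {}" using H.one_closed by (auto intro!: exI[of _ "\<one>\<^bsub>G\<^esub>"] simp del: one_G)
    fix f assume "f \<in> ?K"
    then obtain h where f: "f \<in> carrier G" and h: "h \<in> H" "f i = h i" "M dvd f 0 - h 0" by auto
    have "M dvd - f 0 - - h 0" using h(3) dvd_minus_iff[of M "f 0 - h 0"] by simp
    with f h H.m_inv_closed[OF h(1)] H.mem_carrier[OF h(1)] show "inv\<^bsub>G\<^esub> f \<in> ?K"
      by (auto intro!: inverse_closed bexI[of _ "inv\<^bsub>G\<^esub> h"])
    fix f' assume "f' \<in> ?K"
    then obtain h' where f': "f' \<in> carrier G" and h': "h' \<in> H" "f' i = h' i" "M dvd f' 0 - h' 0" by auto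
    have "M dvd (f 0 + f' 0) - (h 0 + h' 0)" using dvd_add[OF h(3) h'(3)] by (simp add: algebra_simps)
    with f f' h h' H.m_closed[OF h(1) h'(1)] G.m_closed[OF f f'] show "f \<otimes>\<^bsub>G\<^esub> f' \<in> ?K"
      by (auto intro!: bexI[of _ "h \<otimes>\<^bsub>G\<^esub> h'"])
  qed auto
  have "finite (rcosets\<^bsub>G\<^esub> ?K)"
  proof (rule G.finite_rcosetsI[OF K, where \<phi> = "\<lambda>f. (f i, f 0 mod M)"])
    have "(\<lambda>f. (f i, f 0 mod M)) ` carrier G \<subseteq> carrier (P i) \<times> {0..<M}" using M by auto
    then show "finite ((\<lambda>f. (f i, f 0 mod M)) ` carrier G)"
      using P_finite[OF i] finite_subset by blast
    fix f g assume f: "f \<in> carrier G" and g: "g \<in> carrier G" and "(f i, f 0 mod M) = (g i, g 0 mod M)"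
    then have "f i = g i" "M dvd f 0 - g 0" by (auto simp: mod_eq_dvd_iff)
    with f g H.one_closed G.m_closed[OF f inverse_closed[OF g]] show "f \<otimes>\<^bsub>G\<^esub> inv\<^bsub>G\<^esub> g \<in> ?K"
      by (auto intro!: bexI[of _ "\<one>\<^bsub>G\<^esub>"])
  qed
  with K show ?thesis by (simp add: finite_index_subgroup_def)
qed

text \<open>Here coprimality of the orders enters: by the Chinese remainder theorem some power of \<open>h\<close> is \<open>h\<close>
  itself in coordinate \<open>i\<close> and trivial in the remaining finitely many coordinates of the support.\<close>

lemma part_singleton_mem:
  assumes H: "subgroup H G" and h: "h \<in> H" "h \<in> T" and i: "i > 0"
  shows "part {i} h \<in> H"
proof -
  have hG: "h \<in> carrier G" "h 0 = 0" using h by (auto simp: T_def)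
  let ?S = "{j. h j \<noteq> \<one>\<^bsub>P j\<^esub>} - {i}"
  have S: "finite ?S" "\<And>j. j \<in> ?S \<Longrightarrow> j > 0" using T_support[OF h(2)] hG by (auto intro!: Nat.gr0I)
  let ?E = "\<Prod>j\<in>?S. order (P j)"
  have "coprime ?E (order (P i))"
    using S i P_coprime by (intro prod_coprime_left) auto
  then obtain y where y: "[int ?E * y = 1] (mod int (order (P i)))"
    using cong_solve_coprime_int[of "int ?E" "int (order (P i))"]
    unfolding coprime_int_iff by blast
  have "h j [^]\<^bsub>P j\<^esub> (int ?E * y) = part {i} h j" for j
  proof (cases "j = i")
    case True
    have hi: "h i \<in> carrier (P i)" using hG by simp
    have "int (P.ord i (h i)) dvd 1 - int ?E * y"
      using y P.ord_dvd_group_order[OF hi]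
      by (meson cong_iff_dvd_diff cong_sym dvd_trans of_nat_dvd_iff)
    then have "h i [^]\<^bsub>P i\<^esub> (int ?E * y) = h i [^]\<^bsub>P i\<^esub> (1::int)"
      using P.int_pow_eq[OF hi] by blast
    then show ?thesis using True hi by (simp add: part_def)
  next
    case False
    show ?thesis
    proof (cases "j \<in> ?S")
      case True
      then have "order (P j) dvd ?E" using S by (intro dvd_prodI)
      then have "int (order (P j)) dvd int ?E * y" by (intro dvd_mult2) (simp only: of_nat_dvd_iff)
      then show ?thesis using False hG by (simp add: int_pow_order part_def del: of_nat_prod)
    qed (use False in \<open>simp add: part_def\<close>)
  qed
  then have "part {i} h = h [^]\<^bsub>G\<^esub> (int ?E * y)" by (auto simp: int_pow_G[OF hG(1)])
  then show ?thesis using G.subgroup_int_pow_closed[OF H h(1)] by simp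
qed

lemma T_mem_if_coordinates:
  assumes H: "subgroup H G" and g: "g \<in> T"
    and ex: "\<And>i. i > 0 \<Longrightarrow> \<exists>h\<in>H. h \<in> T \<and> h i = g i"
  shows "g \<in> H"
proof -
  have part: "part F g \<in> H" if "finite F" "0 \<notin> F" for F
    using that
  proof (induction F)
    case empty
    have "part {} g = \<one>\<^bsub>G\<^esub>" by (auto simp: part_def)
    then show ?case using subgroup.one_closed[OF H] by simp
  next
    case (insert i F)
    then have i: "i > 0" by (auto intro: Nat.gr0I)
    from ex[OF i] obtain h where h: "h \<in> H" "h \<in> T" "h i = g i" by auto
    have gc: "g j \<in> carrier (P j)" for j using g by (auto simp: T_def)
    have "part (insert i F) g = part {i} h \<otimes>\<^bsub>G\<^esub> part F g"
      using insert.hyps h gc by (auto simp: part_def)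
    then show ?case
      using subgroup.m_closed[OF H part_singleton_mem[OF H h(1,2) i] insert.IH] insert.prems
      by simp
  qed
  have "part {i. g i \<noteq> \<one>\<^bsub>P i\<^esub>} g = g" by (auto simp: part_def)
  moreover have "0 \<notin> {i. g i \<noteq> \<one>\<^bsub>P i\<^esub>}" using g by (simp add: T_def)
  ultimately show ?thesis using part[OF T_support[OF g]] by simp
qed

text \<open>Suppose that \<open>g\<close> has the same image as some element of \<open>H\<close> in each of the finite groups \<open>P i \<times> \<int>/M\<close>.
  Then \<open>g 0\<close> is the exponent of an element of \<open>H\<close>, so \<open>g\<close> may be multiplied by an element of \<open>H\<close> to
  lie in \<open>T\<close>, where it suffices to match each coordinate by an element of \<open>H \<inter> T\<close>.  The
  element of \<open>H\<close> that matches \<open>g\<close> in coordinate \<open>i\<close> is moved into \<open>T\<close> by a power of an element \<open>b\<close> of \<open>H\<close>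
  with least positive exponent; choosing \<open>M\<close> divisible by the order of \<open>P i\<close> ensures that this power
  of \<open>b\<close> is trivial in coordinate \<open>i\<close>.\<close>

lemma ERF_G: "ERF_group G"
proof (rule G.ERF_groupI)
  fix H g assume H: "subgroup H G" and g: "g \<in> carrier G" and gH: "g \<notin> H"
  interpret H: subgroup H G by (rule H)
  let ?K = "\<lambda>i M. {f \<in> carrier G. \<exists>h\<in>H. f i = h i \<and> M dvd f 0 - h 0}"
  have "\<exists>i>0. \<exists>M>0. g \<notin> ?K i M"
  proof (rule ccontr)
    assume "\<not> ?thesis"
    then have K: "\<exists>h\<in>H. g i = h i \<and> M dvd g 0 - h 0" if "i > 0" "M > 0" for i M
      using that by blast
    show False
    proof (cases "H \<subseteq> T")
      case True
      \<comment> \<open>a modulus larger than \<open>g 0\<close> detects that \<open>g 0\<close> vanishes\<close>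
      obtain h where "h \<in> H" "\<bar>g 0\<bar> + 1 dvd g 0 - h 0" using K[of 1 "\<bar>g 0\<bar> + 1"] by auto
      with True have "\<bar>g 0\<bar> + 1 dvd g 0" by (auto simp: T_def)
      then have "g 0 = 0" using dvd_imp_le_int[of "g 0" "\<bar>g 0\<bar> + 1"] by force
      then have "g \<in> T" using g by (simp add: T_def)
      moreover have "\<exists>h\<in>H. h \<in> T \<and> h i = g i" if "i > 0" for i
        using K[OF that, of 1] True by force
      ultimately show False using T_mem_if_coordinates[OF H] gH by blast
    next
      case False
      then obtain a where a: "a \<in> H" "a 0 \<noteq> 0" using H.subset by (auto simp: T_def)
      define n where "n = (LEAST n. n > 0 \<and> (\<exists>h\<in>H. h 0 = int n))"
      have "\<exists>n. n > 0 \<and> (\<exists>h\<in>H. h 0 = int n)"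
      proof (cases "a 0 > 0")
        case True
        then show ?thesis using a by (intro exI[of _ "nat (a 0)"]) auto
      next
        case False
        then show ?thesis using a H.m_inv_closed[OF a(1)] H.mem_carrier[OF a(1)]
          by (intro exI[of _ "nat (- a 0)"]) force
      qed
      from LeastI_ex[OF this] obtain b where n: "n > 0" and b: "b \<in> H" "b 0 = int n"
        unfolding n_def[symmetric] by auto
      have least: "int n \<le> h 0" if "h \<in> H" "h 0 > 0" for h
      proof -
        have "n \<le> nat (h 0)"
          unfolding n_def using that by (intro Least_le conjI bexI[of _ h]) auto
        then show ?thesis using that(2) by linarith
      qed
      have bG: "b \<in> carrier G" using H.mem_carrier b by simp
      have b0: "(b [^]\<^bsub>G\<^esub> k) 0 = k * int n" and bH: "b [^]\<^bsub>G\<^esub> k \<in> H"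
        and bkG: "b [^]\<^bsub>G\<^esub> k \<in> carrier G" for k :: int
        using b G.subgroup_int_pow_closed[OF H b(1)] bG
        by (simp_all add: int_pow_G[OF bG]) (simp add: P0)
      have div: "int n dvd h 0" if h: "h \<in> H" for h
      proof -
        let ?h = "h \<otimes>\<^bsub>G\<^esub> b [^]\<^bsub>G\<^esub> (- (h 0 div int n))"
        have "?h \<in> H" using H.m_closed[OF h bH] .
        then have "?h 0 > 0 \<Longrightarrow> int n \<le> ?h 0" by (rule least)
        moreover have "?h 0 = h 0 mod int n"
          using b0[of "- (h 0 div int n)"] by (simp add: minus_div_mult_eq_mod[symmetric])
        moreover have "h 0 mod int n \<ge> 0" "h 0 mod int n < int n" using n by simp_all
        ultimately have "h 0 mod int n = 0"
          by (metis linorder_not_less order_le_less)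
        then show ?thesis by presburger
      qed
      from K[of 1 "int n"] n obtain h where h: "h \<in> H" "int n dvd g 0 - h 0" by auto
      have "int n dvd g 0" using dvd_add[OF h(2) div[OF h(1)]] by simp
      then obtain k where k: "g 0 = k * int n" by (metis dvd_div_mult_self)
      let ?c = "b [^]\<^bsub>G\<^esub> (- k)"
      have gc: "g \<otimes>\<^bsub>G\<^esub> ?c \<in> T" using G.m_closed[OF g bkG] k b0[of "- k"] by (simp add: T_def)
      have "\<exists>h\<in>H. h \<in> T \<and> h i = (g \<otimes>\<^bsub>G\<^esub> ?c) i" if i: "i > 0" for i
      proof -
        let ?N = "int (order (P i))"
        have N: "?N > 0" using P_finite[OF i] by (simp add: P.order_gt_0_iff_finite)
        obtain h where h: "h \<in> H" "g i = h i" "int n * ?N dvd g 0 - h 0"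
          using K[OF i, of "int n * ?N"] N n by auto
        then obtain l where l: "g 0 - h 0 = int n * ?N * l" by blast
        let ?h = "h \<otimes>\<^bsub>G\<^esub> ?c \<otimes>\<^bsub>G\<^esub> b [^]\<^bsub>G\<^esub> (?N * l)"
        have "?h \<in> H" by (intro H.m_closed bH h)
        moreover have "?h 0 = 0" using k l b0[of "- k"] b0[of "?N * l"] by (simp add: algebra_simps)
        moreover have "?h i = (g \<otimes>\<^bsub>G\<^esub> ?c) i"
          using h(2) H.mem_carrier[OF h(1)] bG by (simp add: int_pow_G[OF bG] int_pow_order)
        ultimately show ?thesis using H.subset by (auto simp: T_def simp del: mult_G)
      qed
      then have "g \<otimes>\<^bsub>G\<^esub> ?c \<in> H" using T_mem_if_coordinates[OF H gc] by simp
      from H.m_closed[OF this H.m_inv_closed[OF bH]] have "g \<otimes>\<^bsub>G\<^esub> (?c \<otimes>\<^bsub>G\<^esub> inv\<^bsub>G\<^esub> ?c) \<in> H"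
        by (simp only: G.m_assoc[OF g bkG G.inv_closed[OF bkG]])
      then have "g \<otimes>\<^bsub>G\<^esub> \<one>\<^bsub>G\<^esub> \<in> H" by (simp only: G.r_inv[OF bkG])
      then show False using gH by (simp only: G.r_one[OF g])
    qed
  qed
  then obtain i M where iM: "i > 0" "M > 0" "g \<notin> ?K i M" by blast
  moreover have "H \<subseteq> ?K i M" using H.subset by force
  ultimately show "\<exists>K. finite_index_subgroup K G \<and> H \<subseteq> K \<and> g \<notin> K"
    using level_finite_index[OF H] by blast
qed

end

section \<open>The affine groups\<close>

text \<open>The finite factors consist of the maps \<open>z \<mapsto> u z + b\<close> on the integers modulo \<open>q = p\<^sup>k\<close> with
  \<open>u \<equiv> 1\<close> modulo \<open>p\<close>, under composition.  Writing \<open>u = 1 + p v\<close> with \<open>0 \<le> v < r = p\<^sup>k\<^sup>-\<^sup>1\<close>, such a map is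
  encoded as the integer \<open>b r + v\<close>.  Thus the elements are exactly the integers from \<open>0\<close> to \<open>q r - 1\<close>,
  the identity is \<open>0\<close>, and the order of the group is a power of \<open>p\<close> by inspection.\<close>

locale affine_mod =
  fixes p k :: nat
  assumes prime_p: "Factorial_Ring.prime p" and k_pos: "k > 0"
begin

definition q :: int where "q = int p ^ k"
definition r :: int where "r = int p ^ (k - 1)"
definition slope :: "int \<Rightarrow> int" where "slope c = 1 + int p * (c mod r)"
definition shift :: "int \<Rightarrow> int" where "shift c = c div r"
definition encode :: "int \<Rightarrow> int \<Rightarrow> int" where
  "encode b u = (b mod q) * r + (u - 1) div int p mod r"

definition A :: "int monoid" where
  "A = \<lparr>carrier = {0..<q * r},
        monoid.mult = (\<lambda>c d. encode (shift c + slope c * shift d) (slope c * slope d)), one = 0\<rparr>"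

lemma p_gt_1: "int p > 1" using prime_gt_1_nat[OF prime_p] by simp
lemma q_eq: "q = int p * r" unfolding q_def r_def using k_pos by (cases k) auto
lemma r_pos: "r > 0" using p_gt_1 by (simp add: r_def)
lemma q_pos: "q > 0" using p_gt_1 by (simp add: q_def)

lemma mult_A:
    "c \<otimes>\<^bsub>A\<^esub> d = encode (shift c + slope c * shift d) (slope c * slope d)"
  and one_A: "\<one>\<^bsub>A\<^esub> = 0"
  and carrier_A: "carrier A = {0..<q * r}"
  by (simp_all add: A_def)

lemma p_dvd_slope: "int p dvd slope c - 1"
  by (simp add: slope_def)

lemma p_dvd_slope_mult: "int p dvd slope c * slope d - 1"
proof -
  have "slope c * slope d - 1 = (slope c - 1) * slope d + (slope d - 1)" by (simp add: algebra_simps)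
  then show ?thesis using p_dvd_slope by (metis dvd_add dvd_mult2)
qed

lemma encode_closed [simp]: "encode b u \<in> carrier A"
proof -
  have "b mod q \<le> q - 1" using q_pos by simp
  then have "(b mod q) * r \<le> (q - 1) * r" using r_pos by (intro mult_right_mono) auto
  moreover have "(u - 1) div int p mod r < r" "0 \<le> (u - 1) div int p mod r" using r_pos by auto
  moreover have "(b mod q) * r \<ge> 0" using q_pos r_pos by simp
  ultimately show ?thesis by (simp add: carrier_A encode_def algebra_simps)
qed

lemma zero_closed: "0 \<in> carrier A"
  using q_pos r_pos by (simp add: carrier_A)

lemma shift_encode: "[shift (encode b u) = b] (mod q)"
  using r_pos by (simp add: shift_def encode_def)

lemma slope_encode:
  assumes "int p dvd u - 1"
  shows "[slope (encode b u) = u] (mod q)"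
proof -
  obtain v where "u - 1 = int p * v" using assms by (rule dvdE)
  then have v: "u = 1 + int p * v" by simp
  have "[int p * (v mod r) = int p * v] (mod q)"
    unfolding q_eq cong_def mult_mod_right[of "int p" v r] by (rule mod_mod_trivial)
  then show ?thesis
    using p_gt_1 unfolding v slope_def encode_def by (auto intro: cong_add)
qed

text \<open>Through this lemma, identities in the group follow from congruences modulo \<open>q\<close> between the
  translation parts and the linear parts, without reference to the encoding.\<close>

lemma A_eqI:
  assumes c: "c \<in> carrier A" and d: "d \<in> carrier A"
    and sh: "[shift c = shift d] (mod q)" and sl: "[slope c = slope d] (mod q)"
  shows "c = d"
proof -
  have range: "0 \<le> shift c \<and> shift c < q" if "c \<in> carrier A" for c
  proof -
    have c: "0 \<le> c" "c < q * r" using that by (auto simp: carrier_A)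
    have "(c div r) * r < q * r" using c(2) minus_mod_eq_div_mult[of c r] pos_mod_sign[OF r_pos, of c] by linarith
    then show ?thesis using c r_pos by (simp add: shift_def pos_imp_zdiv_nonneg_iff)
  qed
  have "shift c = shift d" using sh range[OF c] range[OF d] by (auto simp: cong_def)
  moreover have "c mod r = d mod r"
  proof -
    have "int p * r dvd int p * (c mod r - d mod r)"
      using sl by (simp add: cong_iff_dvd_diff slope_def q_eq right_diff_distrib)
    then have "r dvd c mod r - d mod r" using p_gt_1 by simp
    then show ?thesis using r_pos by (simp add: mod_eq_dvd_iff[symmetric])
  qed
  ultimately show ?thesis unfolding shift_def by (metis div_mult_mod_eq)
qed

lemma A_eqI2:
  assumes "c \<in> carrier A" "d \<in> carrier A"
    and "[shift c = b] (mod q)" "[shift d = b] (mod q)"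
    and "[slope c = u] (mod q)" "[slope d = u] (mod q)"
  shows "c = d"
  by (intro A_eqI assms(1,2) cong_trans[OF assms(3) cong_sym[OF assms(4)]]
      cong_trans[OF assms(5) cong_sym[OF assms(6)]])

lemma shift_mult: "[shift (c \<otimes>\<^bsub>A\<^esub> d) = shift c + slope c * shift d] (mod q)"
  by (simp add: mult_A shift_encode)

lemma slope_mult: "[slope (c \<otimes>\<^bsub>A\<^esub> d) = slope c * slope d] (mod q)"
  by (simp add: mult_A slope_encode p_dvd_slope_mult)

lemma A_closed [simp]: "c \<otimes>\<^bsub>A\<^esub> d \<in> carrier A" "\<one>\<^bsub>A\<^esub> \<in> carrier A"
  by (simp_all add: mult_A one_A zero_closed)

lemma coords_one [simp]: "shift \<one>\<^bsub>A\<^esub> = 0" "slope \<one>\<^bsub>A\<^esub> = 1"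
  by (simp_all add: one_A shift_def slope_def)

lemma coprime_slope: "coprime (slope c) (int p ^ n)"
proof -
  have "coprime (slope c) (int p)"
    unfolding slope_def by (metis coprime_1_left coprime_iff_gcd_eq_1 gcd_add_mult mult.commute add.commute gcd.commute)
  then show ?thesis by simp
qed

lemma group_A: "group A"
proof (rule groupI)
  show "\<one>\<^bsub>A\<^esub> \<in> carrier A" by simp
  fix c assume c: "c \<in> carrier A"
  show "\<one>\<^bsub>A\<^esub> \<otimes>\<^bsub>A\<^esub> c = c"
    using c shift_mult[of "\<one>\<^bsub>A\<^esub>" c] slope_mult[of "\<one>\<^bsub>A\<^esub>" c]
    by (intro A_eqI) (simp_all only: coords_one mult_A encode_closed mult_1 add_0)
  obtain y where y: "[slope c * y = 1] (mod q)"
    using cong_solve_coprime_int[OF coprime_slope] unfolding q_def by blast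
  have py: "int p dvd y - 1"
  proof -
    have "int p dvd slope c * y - 1"
      using y by (metis cong_iff_dvd_diff dvd_mult_left q_eq)
    moreover have "slope c * y - 1 = (slope c - 1) * y + (y - 1)" by (simp add: algebra_simps)
    ultimately show ?thesis using p_dvd_slope[of c] by (metis dvd_add_right_iff dvd_mult2)
  qed
  let ?d = "encode (- y * shift c) y"
  have d: "[shift ?d = - y * shift c] (mod q)" "[slope ?d = y] (mod q)"
    using shift_encode slope_encode py by auto
  have "?d \<otimes>\<^bsub>A\<^esub> c = \<one>\<^bsub>A\<^esub>"
  proof (rule A_eqI)
    have "[shift ?d + slope ?d * shift c = - y * shift c + y * shift c] (mod q)"
      by (intro cong_add cong_mult d cong_refl)
    then show "[shift (?d \<otimes>\<^bsub>A\<^esub> c) = shift \<one>\<^bsub>A\<^esub>] (mod q)"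
      using cong_trans[OF shift_mult] by simp
    have "[slope ?d * slope c = y * slope c] (mod q)" by (intro cong_mult d cong_refl)
    with y have "[slope ?d * slope c = 1] (mod q)" by (metis cong_trans mult.commute)
    then show "[slope (?d \<otimes>\<^bsub>A\<^esub> c) = slope \<one>\<^bsub>A\<^esub>] (mod q)"
      using cong_trans[OF slope_mult] by simp
  qed simp_all
  then show "\<exists>d\<in>carrier A. d \<otimes>\<^bsub>A\<^esub> c = \<one>\<^bsub>A\<^esub>" using encode_closed by blast
next
  fix c d e
  have 1: "[shift (c \<otimes>\<^bsub>A\<^esub> d \<otimes>\<^bsub>A\<^esub> e) = (shift c + slope c * shift d) + slope c * slope d * shift e] (mod q)"
    by (rule cong_trans[OF shift_mult]) (intro cong_add cong_mult shift_mult slope_mult cong_refl)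
  have 2: "[shift (c \<otimes>\<^bsub>A\<^esub> (d \<otimes>\<^bsub>A\<^esub> e)) = shift c + slope c * (shift d + slope d * shift e)] (mod q)"
    by (rule cong_trans[OF shift_mult]) (intro cong_add cong_mult shift_mult slope_mult cong_refl)
  have 3: "[slope (c \<otimes>\<^bsub>A\<^esub> d \<otimes>\<^bsub>A\<^esub> e) = slope c * slope d * slope e] (mod q)"
    by (rule cong_trans[OF slope_mult]) (intro cong_mult slope_mult cong_refl)
  have 4: "[slope (c \<otimes>\<^bsub>A\<^esub> (d \<otimes>\<^bsub>A\<^esub> e)) = slope c * (slope d * slope e)] (mod q)"
    by (rule cong_trans[OF slope_mult]) (intro cong_mult slope_mult cong_refl)
  show "c \<otimes>\<^bsub>A\<^esub> d \<otimes>\<^bsub>A\<^esub> e = c \<otimes>\<^bsub>A\<^esub> (d \<otimes>\<^bsub>A\<^esub> e)"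
  proof (rule A_eqI)
    show "[shift (c \<otimes>\<^bsub>A\<^esub> d \<otimes>\<^bsub>A\<^esub> e) = shift (c \<otimes>\<^bsub>A\<^esub> (d \<otimes>\<^bsub>A\<^esub> e))] (mod q)"
      using cong_trans[OF 1 cong_sym] 2 by (simp add: algebra_simps)
    show "[slope (c \<otimes>\<^bsub>A\<^esub> d \<otimes>\<^bsub>A\<^esub> e) = slope (c \<otimes>\<^bsub>A\<^esub> (d \<otimes>\<^bsub>A\<^esub> e))] (mod q)"
      using cong_trans[OF 3 cong_sym] 4 by (simp add: algebra_simps)
  qed simp_all
qed simp

interpretation A: group A by (rule group_A)

lemma finite_A: "finite (carrier A)"
  by (simp add: carrier_A)

lemma order_A: "order A = p ^ (k + (k - 1))"
proof -
  have "q * r = int (p ^ (k + (k - 1)))" by (simp add: q_def r_def power_add)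
  then show ?thesis unfolding order_def carrier_A card_atLeastLessThan_int by (simp only: diff_0_right nat_int)
qed

text \<open>The identity \<open>y x [x,y] = x y\<close>, read in the two coordinates.\<close>

lemma commutator_coords:
  assumes x: "x \<in> carrier A" and y: "y \<in> carrier A"
  shows "[slope (commutator A x y) = 1] (mod q)"
    and "[slope y * slope x * shift (commutator A x y) =
           (slope x - 1) * shift y - (slope y - 1) * shift x] (mod q)"
proof -
  let ?w = "commutator A x y"
  have e: "y \<otimes>\<^bsub>A\<^esub> x \<otimes>\<^bsub>A\<^esub> ?w = x \<otimes>\<^bsub>A\<^esub> y"
    using x y by (simp add: A.commutator_eq A.m_assoc[symmetric])
  have "[slope y * slope x * slope ?w = slope (y \<otimes>\<^bsub>A\<^esub> x \<otimes>\<^bsub>A\<^esub> ?w)] (mod q)"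
    by (rule cong_sym, rule cong_trans[OF slope_mult]) (intro cong_mult slope_mult cong_refl)
  then have "[slope y * slope x * slope ?w = slope y * slope x * 1] (mod q)"
    unfolding e using cong_trans[OF _ slope_mult] by (simp add: mult.commute)
  moreover have "coprime (slope y * slope x) q"
    unfolding q_def coprime_mult_left_iff using coprime_slope by blast
  ultimately show "[slope ?w = 1] (mod q)" by (simp only: cong_mult_lcancel)
  have "[(shift y + slope y * shift x) + slope y * slope x * shift ?w = shift (y \<otimes>\<^bsub>A\<^esub> x \<otimes>\<^bsub>A\<^esub> ?w)] (mod q)"
    by (rule cong_sym, rule cong_trans[OF shift_mult])
      (intro cong_add cong_mult slope_mult shift_mult cong_refl)
  then have "[(shift y + slope y * shift x) + slope y * slope x * shift ?w = shift x + slope x * shift y] (mod q)"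
    unfolding e using cong_trans[OF _ shift_mult] by blast
  then have "[(shift y + slope y * shift x) + slope y * slope x * shift ?w - (shift y + slope y * shift x)
      = shift x + slope x * shift y - (shift y + slope y * shift x)] (mod q)"
    by (intro cong_diff cong_refl)
  then show "[slope y * slope x * shift ?w =
           (slope x - 1) * shift y - (slope y - 1) * shift x] (mod q)"
    by (simp add: algebra_simps)
qed

definition translation_subgroup :: "int set" where
  "translation_subgroup = {c \<in> carrier A. [slope c = 1] (mod q)}"

lemma translation_mult:
  assumes "c \<in> translation_subgroup" "d \<in> carrier A"
  shows "[shift (c \<otimes>\<^bsub>A\<^esub> d) = shift c + shift d] (mod q)"
    and "[slope (c \<otimes>\<^bsub>A\<^esub> d) = slope d] (mod q)"
proof -
  have s: "[slope c = 1] (mod q)" using assms by (simp add: translation_subgroup_def)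
  have "[shift c + slope c * shift d = shift c + 1 * shift d] (mod q)"
    "[slope c * slope d = 1 * slope d] (mod q)"
    by (intro cong_add cong_mult s cong_refl)+
  then show "[shift (c \<otimes>\<^bsub>A\<^esub> d) = shift c + shift d] (mod q)"
    "[slope (c \<otimes>\<^bsub>A\<^esub> d) = slope d] (mod q)"
    using cong_trans[OF shift_mult] cong_trans[OF slope_mult] by simp_all
qed

lemma commutator_translation:
  "x \<in> carrier A \<Longrightarrow> y \<in> carrier A \<Longrightarrow> commutator A x y \<in> translation_subgroup"
  using commutator_coords(1) by (simp add: translation_subgroup_def)

lemma translation_subgroup_is_subgroup: "subgroup translation_subgroup A"
proof (rule A.subgroupI)
  show "translation_subgroup \<subseteq> carrier A" by (auto simp: translation_subgroup_def)
  have "\<one>\<^bsub>A\<^esub> \<in> translation_subgroup" by (simp add: translation_subgroup_def)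
  then show "translation_subgroup \<noteq> {}" by blast
  fix c assume c: "c \<in> translation_subgroup"
  then have cA: "c \<in> carrier A" by (simp add: translation_subgroup_def)
  show "c \<otimes>\<^bsub>A\<^esub> d \<in> translation_subgroup" if "d \<in> translation_subgroup" for d
    using translation_mult(2)[OF c, of d] that cA unfolding translation_subgroup_def
    by (auto intro: cong_trans)
  have "[slope (c \<otimes>\<^bsub>A\<^esub> inv\<^bsub>A\<^esub> c) = slope (inv\<^bsub>A\<^esub> c)] (mod q)"
    using cA by (intro translation_mult(2) c) auto
  then show "inv\<^bsub>A\<^esub> c \<in> translation_subgroup"
    using cA by (simp add: translation_subgroup_def cong_sym_eq)
qed

lemma translation_commute:
  assumes c: "c \<in> translation_subgroup" and d: "d \<in> translation_subgroup"
  shows "c \<otimes>\<^bsub>A\<^esub> d = d \<otimes>\<^bsub>A\<^esub> c"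
proof (rule A_eqI)
  have cd: "c \<in> carrier A" "d \<in> carrier A" using c d by (auto simp: translation_subgroup_def)
  then show "c \<otimes>\<^bsub>A\<^esub> d \<in> carrier A" "d \<otimes>\<^bsub>A\<^esub> c \<in> carrier A" by simp_all
  show "[shift (c \<otimes>\<^bsub>A\<^esub> d) = shift (d \<otimes>\<^bsub>A\<^esub> c)] (mod q)"
    using cong_trans[OF translation_mult(1)[OF c cd(2)] cong_sym] translation_mult(1)[OF d cd(1)]
    by (simp add: add.commute)
  show "[slope (c \<otimes>\<^bsub>A\<^esub> d) = slope (d \<otimes>\<^bsub>A\<^esub> c)] (mod q)"
    using slope_mult[of c d] slope_mult[of d c] by (metis cong_sym cong_trans mult.commute)
qed

definition translation :: "int \<Rightarrow> int" where "translation n = encode n 1"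

lemma translation_coords: "[shift (translation n) = n] (mod q)" "[slope (translation n) = 1] (mod q)"
  by (simp_all add: translation_def shift_encode slope_encode)

lemma translation_mem: "translation n \<in> translation_subgroup"
  by (simp add: translation_subgroup_def translation_coords) (simp add: translation_def)

lemma translation_eq_one_iff: "translation n = \<one>\<^bsub>A\<^esub> \<longleftrightarrow> q dvd n"
proof
  assume "translation n = \<one>\<^bsub>A\<^esub>"
  then show "q dvd n" using cong_sym[OF translation_coords(1)[of n]] by (simp add: cong_0_iff)
next
  assume "q dvd n"
  then show "translation n = \<one>\<^bsub>A\<^esub>" by (simp add: translation_def encode_def one_A)
qed

lemma translation_hom: "translation \<in> hom integer_group A"
proof (rule homI)
  show "translation x \<in> carrier A" for x by (simp add: translation_def)
  fix m n
  have tm: "translation n \<in> carrier A" for n by (simp add: translation_def)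
  show "translation (m \<otimes>\<^bsub>integer_group\<^esub> n) = translation m \<otimes>\<^bsub>A\<^esub> translation n"
  proof (rule A_eqI)
    have "[shift (translation m) + shift (translation n) = m + n] (mod q)"
      by (intro cong_add translation_coords)
    then show "[shift (translation (m \<otimes>\<^bsub>integer_group\<^esub> n)) = shift (translation m \<otimes>\<^bsub>A\<^esub> translation n)] (mod q)"
      using translation_mult(1)[OF translation_mem tm, of m n] translation_coords(1)[of "m + n"]
      by (simp, metis cong_sym cong_trans)
    show "[slope (translation (m \<otimes>\<^bsub>integer_group\<^esub> n)) = slope (translation m \<otimes>\<^bsub>A\<^esub> translation n)] (mod q)"
      using translation_mult(2)[OF translation_mem tm, of m n] translation_coords(2)[of "m + n"]
        translation_coords(2)[of n]
      by (simp, metis cong_sym cong_trans)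
  qed (use tm in auto)
qed

text \<open>The central series consists of the \<open>c\<close> with \<open>shift c\<close> divisible by \<open>p\<^sup>k\<^sup>-\<^sup>j\<close> and \<open>slope c - 1\<close> by \<open>p\<^sup>k\<^sup>+\<^sup>1\<^sup>-\<^sup>j\<close>.
  The extra power of \<open>p\<close> in the linear part is needed for the term \<open>(slope x - 1) * shift y\<close> of
  \<open>commutator_coords\<close>.\<close>

lemma nilpotent_A: "upper_central A k = carrier A"
proof
  \<comment> \<open>truncated subtraction: for \<open>j = 0\<close> the second exponent is \<open>k\<close>, which already forces \<open>slope c \<equiv> 1\<close>\<close>
  define D where "D j = {c \<in> carrier A. int p ^ (k - j) dvd shift c \<and> int p ^ (k - (j - 1)) dvd slope c - 1}"
    for j
  have "D k \<subseteq> upper_central A k"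
  proof (rule A.central_series_subset_upper_central)
    show "D 0 \<subseteq> {\<one>\<^bsub>A\<^esub>}"
    proof
      fix c assume "c \<in> D 0"
      then have "c \<in> carrier A" "[shift c = shift \<one>\<^bsub>A\<^esub>] (mod q)" "[slope c = slope \<one>\<^bsub>A\<^esub>] (mod q)"
        by (simp_all add: D_def q_def cong_iff_dvd_diff)
      then show "c \<in> {\<one>\<^bsub>A\<^esub>}" using A_eqI[of c "\<one>\<^bsub>A\<^esub>"] A.one_closed by blast
    qed
    show "D j \<subseteq> carrier A" for j by (auto simp: D_def)
    fix j x y assume xD: "x \<in> D (Suc j)" and y: "y \<in> carrier A"
    then have x: "x \<in> carrier A" and x1: "int p ^ (k - Suc j) dvd shift x"
      and x2: "int p ^ (k - j) dvd slope x - 1" by (auto simp: D_def)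
    let ?w = "commutator A x y"
    have dq: "int p ^ i dvd q" if "i \<le> k" for i unfolding q_def using that by (rule le_imp_power_dvd)
    have "int p ^ (k - j) dvd (slope y - 1) * shift x"
    proof (cases "k > j")
      case True
      then have "int p ^ (k - j) = int p * int p ^ (k - Suc j)"
        by (metis Suc_diff_Suc power_Suc)
      then show ?thesis using mult_dvd_mono[OF p_dvd_slope[of y] x1] by simp
    qed simp
    then have "int p ^ (k - j) dvd (slope x - 1) * shift y - (slope y - 1) * shift x"
      by (rule dvd_diff[OF dvd_mult2[OF x2]])
    then have "int p ^ (k - j) dvd slope y * slope x * shift ?w"
      using commutator_coords(2)[OF x y] dq[of "k - j"]
      by (meson cong_dvd_iff cong_dvd_modulus diff_le_self)
    moreover have "coprime (int p ^ (k - j)) (slope y * slope x)"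
      using coprime_slope coprime_commute coprime_mult_left_iff by blast
    ultimately have "int p ^ (k - j) dvd shift ?w" by (simp add: coprime_dvd_mult_right_iff)
    moreover have "int p ^ (k - (j - 1)) dvd slope ?w - 1"
      using commutator_coords(1)[OF x y] dq[of "k - (j - 1)"]
      by (meson cong_iff_dvd_diff diff_le_self dvd_trans)
    ultimately show "?w \<in> D j" using x y by (simp add: D_def)
  qed
  moreover have "D k = carrier A" using k_pos p_dvd_slope by (auto simp: D_def)
  ultimately show "carrier A \<subseteq> upper_central A k" by simp
qed (rule A.upper_central_subset)

text \<open>If \<open>h\<close> is multiplication by \<open>1 + p\<close>, conjugation by \<open>h\<inverse>\<close> multiplies translations by \<open>1 + p\<close>, so
  commutation with \<open>h\<inverse>\<close> multiplies them by \<open>p\<close>.\<close>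

lemma iter_commutator_translation:
  "\<exists>g\<in>carrier A. \<forall>m n. iter_commutator A (translation n) m g = translation (int p ^ m * n)"
proof
  let ?h = "encode 0 (1 + int p)"
  have h: "?h \<in> carrier A" "[shift ?h = 0] (mod q)" "[slope ?h = 1 + int p] (mod q)"
    using shift_encode[of 0] slope_encode[of "1 + int p" 0] by simp_all
  interpret t: group_hom integer_group A translation
    using translation_hom by (simp add: group_hom_def group_hom_axioms_def group_A)
  have tA: "translation n \<in> carrier A" for n by (simp add: translation_def)
  show g: "inv\<^bsub>A\<^esub> ?h \<in> carrier A" using h by simp
  have step: "commutator A (translation n) (inv\<^bsub>A\<^esub> ?h) = translation (int p * n)" for n
  proof -
    have "?h \<otimes>\<^bsub>A\<^esub> translation n = translation ((1 + int p) * n) \<otimes>\<^bsub>A\<^esub> ?h"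
    proof (rule A_eqI2)
      have "[shift ?h + slope ?h * shift (translation n) = 0 + (1 + int p) * n] (mod q)"
        by (intro cong_add cong_mult h translation_coords)
      then show "[shift (?h \<otimes>\<^bsub>A\<^esub> translation n) = (1 + int p) * n] (mod q)"
        using cong_trans[OF shift_mult] by simp
      have "[shift (translation ((1 + int p) * n)) + shift ?h = (1 + int p) * n + 0] (mod q)"
        by (intro cong_add h translation_coords)
      then show "[shift (translation ((1 + int p) * n) \<otimes>\<^bsub>A\<^esub> ?h) = (1 + int p) * n] (mod q)"
        using cong_trans[OF translation_mult(1)[OF translation_mem h(1)]] by simp
      have "[slope ?h * slope (translation n) = (1 + int p) * 1] (mod q)"
        by (intro cong_mult h translation_coords)
      then show "[slope (?h \<otimes>\<^bsub>A\<^esub> translation n) = 1 + int p] (mod q)"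
        using cong_trans[OF slope_mult] by simp
      show "[slope (translation ((1 + int p) * n) \<otimes>\<^bsub>A\<^esub> ?h) = 1 + int p] (mod q)"
        using cong_trans[OF translation_mult(2)[OF translation_mem h(1)] h(3)] .
    qed simp_all
    then have "?h \<otimes>\<^bsub>A\<^esub> translation n \<otimes>\<^bsub>A\<^esub> inv\<^bsub>A\<^esub> ?h = translation ((1 + int p) * n)"
      using tA h A.inv_solve_right' by (simp add: A.m_assoc)
    then have "commutator A (translation n) (inv\<^bsub>A\<^esub> ?h) = translation (- n) \<otimes>\<^bsub>A\<^esub> translation ((1 + int p) * n)"
      using t.hom_inv[of n] h by (simp add: commutator_def conjug_def)
    also have "\<dots> = translation (int p * n)"
      using t.hom_mult[of "- n" "(1 + int p) * n"] by (simp add: algebra_simps)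
    finally show ?thesis .
  qed
  show "\<forall>m n. iter_commutator A (translation n) m (inv\<^bsub>A\<^esub> ?h) = translation (int p ^ m * n)"
  proof (intro allI)
    fix m n show "iter_commutator A (translation n) m (inv\<^bsub>A\<^esub> ?h) = translation (int p ^ m * n)"
      by (induction m) (simp_all add: step mult.assoc)
  qed
qed

lemma translation_not_bounded_engel:
  assumes n: "n \<noteq> 0" "\<bar>n\<bar> < int p" and m: "m < k"
  shows "\<exists>g\<in>carrier A. iter_commutator A (translation n) m g \<noteq> \<one>\<^bsub>A\<^esub>"
proof -
  have "\<not> q dvd int p ^ m * n"
  proof
    assume "q dvd int p ^ m * n"
    moreover have "int p ^ m * int p dvd q"
      unfolding q_def using m by (metis Suc_leI le_imp_power_dvd power_Suc2)
    ultimately have "int p ^ m * int p dvd int p ^ m * n" by (rule dvd_trans[rotated])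
    then have "int p dvd n" using p_gt_1 by simp
    then show False using n zdvd_not_zless[of "\<bar>n\<bar>" "int p"] by simp
  qed
  then show ?thesis using iter_commutator_translation translation_eq_one_iff by metis
qed

end

section \<open>The example\<close>

text \<open>The exponent \<open>i\<close> of the \<open>i\<close>-th modulus makes the Engel degrees of the diagonal element unbounded; the
  growth of the primes keeps a given \<open>n \<noteq> 0\<close> prime to almost all of them.\<close>

lemma diagonal_extension_affine:
  fixes pr :: "nat \<Rightarrow> nat"
  assumes prime: "\<And>i. Factorial_Ring.prime (pr i)" and inj: "inj pr" and ge: "\<And>i. i \<le> pr i"
  defines "P \<equiv> \<lambda>i. if i = 0 then integer_group else affine_mod.A (pr i) i"
    and "B \<equiv> \<lambda>i. if i = 0 then UNIV else affine_mod.translation_subgroup (pr i) i"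
    and "d \<equiv> \<lambda>i. if i = 0 then (\<lambda>n. n) else affine_mod.translation (pr i) i"
  shows "diagonal_extension P B d"
proof -
  have P0: "P 0 = integer_group" "B 0 = UNIV" "d 0 = (\<lambda>n. n)" by (auto simp: P_def B_def d_def)
  have Pi: "P i = affine_mod.A (pr i) i" "B i = affine_mod.translation_subgroup (pr i) i"
    "d i = affine_mod.translation (pr i) i" if "i > 0" for i
    using that by (auto simp: P_def B_def d_def)
  have aff: "affine_mod (pr i) i" if "i > 0" for i using prime that by (simp add: affine_mod_def)
  note Z = group.upper_central_Suc_iff[OF group_integer_group]
  show ?thesis
  proof (rule diagonal_extension.intro)
    fix i
    show "group (P i)"
      by (cases "i = 0") (simp_all add: P0 Pi affine_mod.group_A[OF aff])
    show "\<exists>c. upper_central (P i) c = carrier (P i)"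
    proof (cases "i = 0")
      case True
      have "upper_central integer_group (Suc 0) = UNIV"
        using Z[of _ 0] by (auto simp: commutator_def conjug_def simp del: upper_central.simps(2))
      then show ?thesis using True P0 by (metis carrier_integer_group)
    next
      case False
      then show ?thesis using affine_mod.nilpotent_A[OF aff] Pi by auto
    qed
    show "subgroup (B i) (P i)"
      using group.subgroup_self[OF group_integer_group]
      by (cases "i = 0") (simp_all add: P0 Pi affine_mod.translation_subgroup_is_subgroup[OF aff])
    show "d i \<in> hom integer_group (P i)"
      by (cases "i = 0") (simp add: P0 hom_def, simp add: Pi affine_mod.translation_hom[OF aff])
    show "d i n \<in> B i" for n
      by (cases "i = 0") (simp_all add: P0 Pi affine_mod.translation_mem[OF aff])
    show "x \<otimes>\<^bsub>P i\<^esub> y = y \<otimes>\<^bsub>P i\<^esub> x" if "x \<in> B i" "y \<in> B i" for x y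
      using that affine_mod.translation_commute[OF aff, of i x y]
      by (cases "i = 0") (simp_all add: P0 Pi)
    show "commutator (P i) x y \<in> B i" if "x \<in> carrier (P i)" "y \<in> carrier (P i)" for x y
      using that affine_mod.commutator_translation[OF aff, of i x y]
      by (cases "i = 0") (simp_all add: P0 Pi)
    show "finite (carrier (P i))" if "i > 0"
      using affine_mod.finite_A[OF aff[OF that]] Pi[OF that] by simp
    show "coprime (order (P i)) (order (P j))" if "i > 0" "j > 0" "i \<noteq> j" for j
    proof -
      have "pr i \<noteq> pr j" using inj that by (auto dest: injD)
      then have "coprime (pr i) (pr j)" using prime by (simp add: primes_coprime)
      then show ?thesis using that by (simp add: Pi affine_mod.order_A[OF aff])
    qed
  next
    show "P 0 = integer_group" "d 0 n = n" for n by (simp_all add: P0)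
    fix n :: int and m assume n: "n \<noteq> 0"
    have "\<exists>g\<in>carrier (P i). iter_commutator (P i) (d i n) m g \<noteq> \<one>\<^bsub>P i\<^esub>"
      if i: "i \<ge> Suc (m + nat \<bar>n\<bar>)" for i
    proof -
      have "i > 0" "m < i" "\<bar>n\<bar> < int (pr i)" using i ge[of i] by linarith+
      then show ?thesis using affine_mod.translation_not_bounded_engel[OF aff n] by (simp add: Pi)
    qed
    then show "\<exists>N. \<forall>i\<ge>N. \<exists>g\<in>carrier (P i). iter_commutator (P i) (d i n) m g \<noteq> \<one>\<^bsub>P i\<^esub>" by blast
  qed
qed

theorem mainTheorem3:
  shows "\<exists>G :: (nat \<Rightarrow> int) monoid.
    group G \<and>
    \<not> periodic_set G (carrier G) \<and>
    metabelian G \<and>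
    FC2_group G \<and>
    bounded_right_engel G = upper_central_omega G \<and>
    right_engel G = upper_central_omega_Suc G \<and>
    upper_central_omega_Suc G = carrier G \<and>
    periodic_set G (upper_central_omega G) \<and>
    ERF_group G"
proof -
  let ?pr = "enumerate {p::nat. Factorial_Ring.prime p}"
  have "Factorial_Ring.prime (?pr i)" "i \<le> ?pr i" for i
    using enumerate_in_set[OF primes_infinite, of i] le_enumerate[OF primes_infinite, of i] by auto
  moreover have "inj ?pr"
    using strict_mono_enumerate[OF primes_infinite] by (rule strict_mono_imp_inj_on)
  ultimately obtain P B d where "diagonal_extension P B d"
    using diagonal_extension_affine[of ?pr] by blast
  then interpret diagonal_extension P B d .
  show ?thesis
    using group_G not_periodic metabelian_G FC2_G bounded_eq_T omega_eq_T right_engel_G omega_Suc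
      periodic_omega ERF_G
    by (intro exI[of _ G]) simp
qed

end
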